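(* Consider the matrix completion model $Y_{ij}=E_{ij}(\theta_{ij}+\xi_{ij})$, $i\in[n]$, $j\in[m]$, where the $E_{ij}$ are i.i.d. Bernoulli variables with parameter $p\in(0,1]$, independent of $(\xi_{ij})$. Let the noise variables $\xi_{ij}$ be independent with Gaussian distribution $\mathcal{N}(0,\sigma^2)$, $\sigma>0$, and let the alphabets $\mathcal{D}_n$ and $\mathcal{D}_m$ contain the set $\{0,1\}$. There exists an absolute constant $C>0$ such that $$\inf_{\hat\vartheta}\ \sup_{\theta\in\Theta(s_n,s_m)}\mathbb{P}_\theta\left\{\|\hat\vartheta-\theta\|_2^2\ge\frac{C\sigma^2}{p}(R_X+R_B+R_Z)\right\}\ge0.1$$ and $$\inf_{\hat\vartheta}\ \sup_{\theta\in\Theta(s_n,s_m)}\mathbb{E}_\theta\|\hat\vartheta-\theta\|_2^2\ge\frac{C\sigma^2}{p}(R_X+R_B+R_Z),$$ where $\inf_{\hat\vartheta}$ is the infimum over all estimators (functions of $Y$) with values in $\mathbb{R}^{n\times m}$. Furthermore, the same inequalities hold with $\Theta_*(s_n,s_m)$ in place of $\Theta(s_n,s_m)$ if $s_n\in\{0,1\}$ and $s_m\in\{0,1\}$.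
   Context: Here $[i]=\{1,\dots,i\}$, $\|\cdot\|_2$ is the Frobenius norm, $\|x\|_0$ is the number of non-zero components of a vector $x$, and $a\wedge b=\min(a,b)$. $\mathbb{P}_\theta$, $\mathbb{E}_\theta$ denote probability and expectation under the distribution of $Y$ when the signal matrix is $\theta$. Let $n,m,k_n,k_m\ge1$ and $s_n,s_m$ be integers with $0\le s_n\le k_n$, $0\le s_m\le k_m$. Let $\mathcal{D}_n,\mathcal{D}_m\subset\mathbb{R}$ (alphabets). For $1\le s_n\le k_n$, $$\mathcal{A}_{s_n}=\{A\in\mathcal{D}_n^{n\times k_n}:\ \|A_{i\cdot}\|_0\le s_n\text{ for all }i\in[n]\},$$ where $A_{i\cdot}$ is the $i$th row; for $s_n=0$ it is assumed that $n=k_n$ and $\mathcal{A}_{s_n}$ contains only the $n\times n$ identity matrix. $\mathcal{A}_{s_m}$ is defined analogously with $n$ replaced by $m$. The structured class is $$\Theta(s_n,s_m)=\{\theta=XBZ^T:\ X\in\mathcal{A}_{s_n},\ B\in\mathbb{R}^{k_n\times k_m},\ Z\in\mathcal{A}_{s_m}\}\subset\mathbb{R}^{n\times m}.$$ The class $\Theta_*(s_n,s_m)$ is defined in the same way except that, when $s_n\ge1$ (respectively $s_m\ge1$), the row-sparsity inequality $\|A_{i\cdot}\|_0\le s_n$ (respectively $\le s_m$) is replaced by the equality $\|A_{i\cdot}\|_0=s_n$ (respectively $=s_m$). Set $r_n=n\wedge k_n$, $r_m=m\wedge k_m$, and $$R_X=nr_m\wedge ns_n\log\frac{ek_n}{s_n},\qquad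 R_B=r_nr_m,\qquad R_Z=mr_n\wedge ms_m\log\frac{ek_m}{s_m},$$ with the convention $0\log\frac{x}{0}=0$ for $x>0$.
   Formalization: For Θ_*, the cases s_n=k_n=1 with D_n={0,1}, and s_m=k_m=1 with D_m={0,1}, are excluded: there the factor is forced to be the all-ones column and the claimed bound fails (e.g. m=k_m=1, s_m=0, n large). *)

theory Defs
  imports "HOL-Probability.Probability" "Jordan_Normal_Form.Matrix"
begin

definition l0_norm :: "real vec \<Rightarrow> nat" where
  "l0_norm x = card {j. j < dim_vec x \<and> vec_index x j \<noteq> 0}"

definition frobenius_norm :: "real mat \<Rightarrow> real" where
  "frobenius_norm A = sqrt (\<Sum>i<dim_row A. \<Sum>j<dim_col A. (A $$ (i, j))\<^sup>2)"


subsection \<open>Structured matrices\<close>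

text \<open>For \<open>s = 0\<close> the class consists of the identity matrix only and is used with \<open>n = k\<close>.\<close>

definition factor_class :: "real set \<Rightarrow> nat \<Rightarrow> nat \<Rightarrow> nat \<Rightarrow> real mat set" where
  "factor_class D n k s =
     (if s = 0 then {1\<^sub>m n}
      else {A \<in> carrier_mat n k. elements_mat A \<subseteq> D \<and> (\<forall>i<n. l0_norm (row A i) \<le> s)})"

definition factor_class_exact :: "real set \<Rightarrow> nat \<Rightarrow> nat \<Rightarrow> nat \<Rightarrow> real mat set" where
  "factor_class_exact D n k s =
     (if s = 0 then {1\<^sub>m n}
      else {A \<in> carrier_mat n k. elements_mat A \<subseteq> D \<and> (\<forall>i<n. l0_norm (row A i) = s)})"

text \<open>If \<open>s = k = 1\<close> and \<open>D = {0, 1}\<close>, then \<open>factor_class_exact D n k s\<close> contains only the all-ones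
  column. The factor is then known, the signal has identical rows, and no lower bound of order
  \<open>n\<close> can hold; the lower bound for \<open>signal_class_exact\<close> therefore has to leave this case out.\<close>

definition signal_class ::
  "real set \<Rightarrow> real set \<Rightarrow> nat \<Rightarrow> nat \<Rightarrow> nat \<Rightarrow> nat \<Rightarrow> nat \<Rightarrow> nat \<Rightarrow> real mat set" where
  "signal_class D\<^sub>n D\<^sub>m n m k\<^sub>n k\<^sub>m s\<^sub>n s\<^sub>m =
     {X * B * transpose_mat Z | X B Z.
        X \<in> factor_class D\<^sub>n n k\<^sub>n s\<^sub>n \<and> B \<in> carrier_mat k\<^sub>n k\<^sub>m \<and> Z \<in> factor_class D\<^sub>m m k\<^sub>m s\<^sub>m}"

definition signal_class_exact ::
  "real set \<Rightarrow> real set \<Rightarrow> nat \<Rightarrow> nat \<Rightarrow> nat \<Rightarrow> nat \<Rightarrow> nat \<Rightarrow> nat \<Rightarrow> real mat set" where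
  "signal_class_exact D\<^sub>n D\<^sub>m n m k\<^sub>n k\<^sub>m s\<^sub>n s\<^sub>m =
     {X * B * transpose_mat Z | X B Z.
        X \<in> factor_class_exact D\<^sub>n n k\<^sub>n s\<^sub>n \<and> B \<in> carrier_mat k\<^sub>n k\<^sub>m \<and>
        Z \<in> factor_class_exact D\<^sub>m m k\<^sub>m s\<^sub>m}"


subsection \<open>Rates\<close>

text \<open>\<open>factor_rate n k s r\<close> is the complexity of the left factor for \<open>r = min m k\<^sub>m\<close>, and of the
  right factor with the roles of the two dimensions exchanged. For \<open>s = 0\<close> the second argument
  of the minimum is \<open>0\<close>, in accordance with the convention \<open>0 log (x / 0) = 0\<close>.\<close>

definition factor_rate :: "nat \<Rightarrow> nat \<Rightarrow> nat \<Rightarrow> nat \<Rightarrow> real" where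
  "factor_rate n k s r =
     min (real n * real r) (real n * real s * ln (exp 1 * real k / real s))"

definition total_rate :: "nat \<Rightarrow> nat \<Rightarrow> nat \<Rightarrow> nat \<Rightarrow> nat \<Rightarrow> nat \<Rightarrow> real" where
  "total_rate n m k\<^sub>n k\<^sub>m s\<^sub>n s\<^sub>m =
     factor_rate n k\<^sub>n s\<^sub>n (min m k\<^sub>m) + real (min n k\<^sub>n) * real (min m k\<^sub>m) +
     factor_rate m k\<^sub>m s\<^sub>m (min n k\<^sub>n)"


subsection \<open>The matrix completion model\<close>

text \<open>Matrix entries are numbered from \<open>0\<close>, as for the type \<^typ>\<open>real mat\<close>.\<close>

abbreviation entries :: "nat \<Rightarrow> nat \<Rightarrow> (nat \<times> nat) set" where
  "entries n m \<equiv> {..<n} \<times> {..<m}"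

abbreviation obs_space :: "nat \<Rightarrow> nat \<Rightarrow> (nat \<times> nat \<Rightarrow> real) measure" where
  "obs_space n m \<equiv> PiM (entries n m) (\<lambda>_. borel)"

text \<open>The joint law of the mask \<open>E\<close> and the noise \<open>\<xi>\<close>.\<close>

definition mask_noise ::
  "nat \<Rightarrow> nat \<Rightarrow> real \<Rightarrow> real \<Rightarrow> ((nat \<times> nat \<Rightarrow> bool) \<times> (nat \<times> nat \<Rightarrow> real)) measure" where
  "mask_noise n m p \<sigma> =
     PiM (entries n m) (\<lambda>_. measure_pmf (bernoulli_pmf p)) \<Otimes>\<^sub>M
     PiM (entries n m) (\<lambda>_. density lborel (normal_density 0 \<sigma>))"

definition observation ::
  "nat \<Rightarrow> nat \<Rightarrow> real mat \<Rightarrow> (nat \<times> nat \<Rightarrow> bool) \<times> (nat \<times> nat \<Rightarrow> real) \<Rightarrow> nat \<times> nat \<Rightarrow> real" where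
  "observation n m \<theta> = (\<lambda>(E, \<xi>). \<lambda>ij \<in> entries n m. of_bool (E ij) * (\<theta> $$ ij + \<xi> ij))"

text \<open>The distribution of \<open>Y\<close> under the signal matrix \<open>\<theta>\<close>.\<close>

definition completion_law ::
  "nat \<Rightarrow> nat \<Rightarrow> real \<Rightarrow> real \<Rightarrow> real mat \<Rightarrow> (nat \<times> nat \<Rightarrow> real) measure" where
  "completion_law n m p \<sigma> \<theta> = distr (mask_noise n m p \<sigma>) (obs_space n m) (observation n m \<theta>)"

lemma measurable_observation:
  "observation n m \<theta> \<in> measurable (mask_noise n m p \<sigma>) (obs_space n m)"
  unfolding observation_def mask_noise_def case_prod_beta
  by (rule measurable_restrict) measurable

lemma prob_space_completion_law:
  assumes "\<sigma> > 0"
  shows "prob_space (completion_law n m p \<sigma> \<theta>)"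
proof -
  interpret N: prob_space "density lborel (normal_density 0 \<sigma>)"
    using assms by (rule prob_space_normal_density)
  interpret PE: prob_space "PiM (entries n m) (\<lambda>_. measure_pmf (bernoulli_pmf p))"
    by (rule prob_space_PiM) (rule measure_pmf.prob_space_axioms)
  interpret PN: prob_space "PiM (entries n m) (\<lambda>_. density lborel (normal_density 0 \<sigma>))"
    by (rule prob_space_PiM) (rule N.prob_space_axioms)
  interpret P: pair_prob_space "PiM (entries n m) (\<lambda>_. measure_pmf (bernoulli_pmf p))"
    "PiM (entries n m) (\<lambda>_. density lborel (normal_density 0 \<sigma>))" ..
  show ?thesis
    unfolding completion_law_def
    by (rule prob_space.prob_space_distr[OF _ measurable_observation])
      (simp add: mask_noise_def P.prob_space_axioms)
qed


subsection \<open>Minimax quantities\<close>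

definition estimators :: "nat \<Rightarrow> nat \<Rightarrow> ((nat \<times> nat \<Rightarrow> real) \<Rightarrow> real mat) set" where
  "estimators n m =
     {T. (\<forall>y \<in> space (obs_space n m). T y \<in> carrier_mat n m) \<and>
         (\<forall>ij \<in> entries n m. (\<lambda>y. T y $$ ij) \<in> borel_measurable (obs_space n m))}"

definition minimax_prob :: "nat \<Rightarrow> nat \<Rightarrow> real \<Rightarrow> real \<Rightarrow> real mat set \<Rightarrow> real \<Rightarrow> ennreal" where
  "minimax_prob n m p \<sigma> \<Theta> t =
     (INF T \<in> estimators n m. SUP \<theta> \<in> \<Theta>.
        emeasure (completion_law n m p \<sigma> \<theta>)
          {y \<in> space (completion_law n m p \<sigma> \<theta>). (frobenius_norm (T y - \<theta>))\<^sup>2 \<ge> t})"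

definition minimax_risk :: "nat \<Rightarrow> nat \<Rightarrow> real \<Rightarrow> real \<Rightarrow> real mat set \<Rightarrow> ennreal" where
  "minimax_risk n m p \<sigma> \<Theta> =
     (INF T \<in> estimators n m. SUP \<theta> \<in> \<Theta>.
        \<integral>\<^sup>+ y. ennreal ((frobenius_norm (T y - \<theta>))\<^sup>2) \<partial>completion_law n m p \<sigma> \<theta>)"

end

theory Submission
  imports Defs
begin

text \<open>Each of the three terms of the rate is witnessed by a cube of signals: a family indexed by the
  subsets of a set of \<open>N\<close> independent bits, each of which shifts its own block of entries by a total
  squared amount \<open>\<sigma>\<^sup>2 / p\<close>. Since \<open>N\<close> is the only complexity that enters, neither Fano's inequality
  nor a packing argument is needed. Changing one bit moves the law of \<open>Y\<close>, a product over the
  entries, so little in Hellinger distance that the bit cannot be tested reliably; on average over the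
  cube at least a quarter of the bits are therefore decoded wrongly, and every wrong bit costs \<open>\<sigma>\<^sup>2 / (4 p)\<close>.

  For \<open>R\<^sub>B\<close> the bits are the entries of \<open>B\<close>. For \<open>R\<^sub>X\<close> the rows of \<open>X\<close> carry the bits: the
  columns of \<open>X\<close> are labelled injectively by the nonempty subsets of \<open>s\<close> disjoint blocks of about
  \<open>log (e k / s)\<close> bits, \<open>B\<close> translates labels into bits, and a row of \<open>X\<close> selects at most one label
  per block. The case of \<open>R\<^sub>Z\<close> is its transpose.\<close>

section \<open>The law of the observations\<close>

definition entry_law :: "real \<Rightarrow> real \<Rightarrow> real \<Rightarrow> real measure" where
  "entry_law p \<sigma> t = distr (measure_pmf (bernoulli_pmf p) \<Otimes>\<^sub>M density lborel (normal_density 0 \<sigma>))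
     borel (\<lambda>(e, x). of_bool e * (t + x))"

lemma sets_entry_law [measurable_cong, simp]: "sets (entry_law p \<sigma> t) = sets borel"
  by (simp add: entry_law_def)

lemma space_entry_law [simp]: "space (entry_law p \<sigma> t) = UNIV"
  by (simp add: entry_law_def)

lemma measurable_masked_shift [measurable]:
  "(\<lambda>(e, x). of_bool e * (t + x)) \<in> borel_measurable
     (measure_pmf (bernoulli_pmf p) \<Otimes>\<^sub>M density lborel (normal_density 0 \<sigma>))" for t :: real
  unfolding case_prod_beta by measurable

lemma prob_space_entry_law:
  assumes "\<sigma> > 0"
  shows "prob_space (entry_law p \<sigma> t)"
proof -
  interpret N: prob_space "density lborel (normal_density 0 \<sigma>)"
    using assms by (rule prob_space_normal_density)
  interpret P: pair_prob_space "measure_pmf (bernoulli_pmf p)" "density lborel (normal_density 0 \<sigma>)" ..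
  show ?thesis
    unfolding entry_law_def by (rule P.prob_space_distr) (rule measurable_masked_shift)
qed

text \<open>Conditioning on the mask: the observation is \<open>0\<close> with probability
  \<open>1 - p\<close> and Gaussian around \<open>t\<close> otherwise. The computations with
  likelihood ratios go through this mixture formula.\<close>

lemma nn_integral_entry_law:
  assumes "0 < p" "p \<le> 1" "\<sigma> > 0" and [measurable]: "f \<in> borel_measurable borel"
  shows "(\<integral>\<^sup>+ y. f y \<partial>entry_law p \<sigma> t) =
    ennreal (1 - p) * f 0 + ennreal p * (\<integral>\<^sup>+ x. ennreal (normal_density t \<sigma> x) * f x \<partial>lborel)"
proof -
  interpret N: prob_space "density lborel (normal_density 0 \<sigma>)"
    using assms by (intro prob_space_normal_density)
  have "(\<integral>\<^sup>+ y. f y \<partial>entry_law p \<sigma> t) =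
    (\<integral>\<^sup>+ z. f (case z of (e, x) \<Rightarrow> of_bool e * (t + x))
      \<partial>(measure_pmf (bernoulli_pmf p) \<Otimes>\<^sub>M density lborel (normal_density 0 \<sigma>)))"
    unfolding entry_law_def by (subst nn_integral_distr) auto
  also have "\<dots> = (\<integral>\<^sup>+ e. \<integral>\<^sup>+ x. f (of_bool e * (t + x)) \<partial>density lborel (normal_density 0 \<sigma>)
      \<partial>measure_pmf (bernoulli_pmf p))"
    by (subst N.nn_integral_fst[symmetric]) auto
  also have "\<dots> = ennreal (1 - p) * f 0 + ennreal p * (\<integral>\<^sup>+ x. f (t + x) \<partial>density lborel (normal_density 0 \<sigma>))"
    using assms N.emeasure_space_1 by (simp add: mult.commute add.commute)
  also have "(\<integral>\<^sup>+ x. f (t + x) \<partial>density lborel (normal_density 0 \<sigma>)) =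
      (\<integral>\<^sup>+ x. ennreal (normal_density 0 \<sigma> x) * f (t + x) \<partial>lborel)"
    by (subst nn_integral_density) auto
  also have "\<dots> = (\<integral>\<^sup>+ x. ennreal (normal_density t \<sigma> x) * f x \<partial>lborel)"
    by (subst (2) nn_integral_real_affine[where c=1 and t=t]) (auto simp: normal_density_def)
  finally show ?thesis .
qed

text \<open>The law of an entry has an atom of mass \<open>1 - p\<close> at \<open>0\<close>, whatever the signal; hence the
  likelihood ratio is \<open>1\<close> there.\<close>

definition entry_ratio :: "real \<Rightarrow> real \<Rightarrow> real \<Rightarrow> real \<Rightarrow> real" where
  "entry_ratio \<sigma> s t y = (if y = 0 then 1 else normal_density t \<sigma> y / normal_density s \<sigma> y)"

lemma entry_ratio_nonneg: "entry_ratio \<sigma> s t y \<ge> 0"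
  by (simp add: entry_ratio_def)

lemma borel_measurable_entry_ratio [measurable]: "entry_ratio \<sigma> s t \<in> borel_measurable borel"
  unfolding entry_ratio_def by measurable

lemma nn_integral_normal_density:
  assumes "\<sigma> > 0"
  shows "(\<integral>\<^sup>+ x. ennreal (normal_density t \<sigma> x) \<partial>lborel) = 1"
proof -
  interpret N: prob_space "density lborel (normal_density t \<sigma>)"
    using assms by (rule prob_space_normal_density)
  show ?thesis
    using N.emeasure_space_1 by (subst (asm) emeasure_density) auto
qed

text \<open>The atoms at \<open>0\<close> have equal mass, so the ratio \<open>1\<close> is right
  there; the Gaussian parts see \<open>0\<close> as a null set, so the special value at that point
  does not affect them.\<close>

lemma nn_integral_entry_ratio:
  assumes "0 < p" "p \<le> 1" "\<sigma> > 0" and [measurable]: "f \<in> borel_measurable borel"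
  shows "(\<integral>\<^sup>+ y. ennreal (entry_ratio \<sigma> s t y) * f y \<partial>entry_law p \<sigma> s) =
    (\<integral>\<^sup>+ y. f y \<partial>entry_law p \<sigma> t)"
proof -
  have "(\<integral>\<^sup>+ x. ennreal (normal_density s \<sigma> x) * (ennreal (entry_ratio \<sigma> s t x) * f x) \<partial>lborel) =
    (\<integral>\<^sup>+ x. ennreal (normal_density t \<sigma> x) * f x \<partial>lborel)"
  proof (rule nn_integral_cong_AE, use AE_lborel_singleton[of 0] in eventually_elim)
    fix x :: real assume "x \<noteq> 0"
    moreover have "normal_density s \<sigma> x > 0"
      using assms by (intro normal_density_pos)
    ultimately show "ennreal (normal_density s \<sigma> x) * (ennreal (entry_ratio \<sigma> s t x) * f x) =
        ennreal (normal_density t \<sigma> x) * f x"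
      by (simp add: entry_ratio_def mult.assoc[symmetric] ennreal_mult[symmetric])
  qed
  moreover have "entry_ratio \<sigma> s t 0 = 1" by (simp add: entry_ratio_def)
  ultimately show ?thesis
    using assms by (simp add: nn_integral_entry_law)
qed

text \<open>Completing the square: \<open>(x - s)^2 + (x - t)^2\<close> is twice the squared
  distance from \<open>x\<close> to the midpoint plus \<open>(s - t)^2 / 2\<close>.\<close>

lemma sqrt_normal_density_mult:
  assumes "\<sigma> > 0"
  shows "sqrt (normal_density s \<sigma> x * normal_density t \<sigma> x) =
    exp (- (s - t)\<^sup>2 / (8 * \<sigma>\<^sup>2)) * normal_density ((s + t) / 2) \<sigma> x"
proof (rule real_sqrt_unique)
  have "(exp (- (s - t)\<^sup>2 / (8 * \<sigma>\<^sup>2)) * exp (- (x - (s + t) / 2)\<^sup>2 / (2 * \<sigma>\<^sup>2)))\<^sup>2 =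
    exp (- (x - s)\<^sup>2 / (2 * \<sigma>\<^sup>2)) * exp (- (x - t)\<^sup>2 / (2 * \<sigma>\<^sup>2))"
    using assms unfolding exp_add[symmetric] exp_double[symmetric]
    by (simp add: field_simps power2_eq_square)
  then show "(exp (- (s - t)\<^sup>2 / (8 * \<sigma>\<^sup>2)) * normal_density ((s + t) / 2) \<sigma> x)\<^sup>2 =
      normal_density s \<sigma> x * normal_density t \<sigma> x"
    by (simp add: normal_density_def power_mult_distrib power_divide field_simps power2_eq_square)
qed (use assms in simp)

text \<open>This is the Hellinger affinity of two entry laws: the common atom contributes
  \<open>1 - p\<close>, the Gaussian parts contribute \<open>p\<close> times the factor split off in
  \<open>sqrt_normal_density_mult\<close>.\<close>

lemma nn_integral_sqrt_entry_ratio: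
  assumes "0 < p" "p \<le> 1" "\<sigma> > 0"
  shows "(\<integral>\<^sup>+ y. ennreal (sqrt (entry_ratio \<sigma> s t y)) \<partial>entry_law p \<sigma> s) =
    ennreal (1 - p + p * exp (- (s - t)\<^sup>2 / (8 * \<sigma>\<^sup>2)))"
proof -
  have "(\<integral>\<^sup>+ x. ennreal (normal_density s \<sigma> x) * ennreal (sqrt (entry_ratio \<sigma> s t x)) \<partial>lborel) =
    (\<integral>\<^sup>+ x. ennreal (exp (- (s - t)\<^sup>2 / (8 * \<sigma>\<^sup>2))) * ennreal (normal_density ((s + t) / 2) \<sigma> x) \<partial>lborel)"
  proof (rule nn_integral_cong_AE, use AE_lborel_singleton[of 0] in eventually_elim)
    fix x :: real assume x: "x \<noteq> 0"
    have pos: "normal_density s \<sigma> x > 0"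
      using assms by (intro normal_density_pos)
    have "normal_density s \<sigma> x * sqrt (entry_ratio \<sigma> s t x) =
        sqrt ((normal_density s \<sigma> x)\<^sup>2 * (normal_density t \<sigma> x / normal_density s \<sigma> x))"
      using x pos by (simp add: entry_ratio_def real_sqrt_mult del: times_divide_eq_right)
    also have "(normal_density s \<sigma> x)\<^sup>2 * (normal_density t \<sigma> x / normal_density s \<sigma> x) =
        normal_density s \<sigma> x * normal_density t \<sigma> x"
      using pos by (simp add: power2_eq_square)
    also note sqrt_normal_density_mult[OF assms(3)]
    finally show "ennreal (normal_density s \<sigma> x) * ennreal (sqrt (entry_ratio \<sigma> s t x)) =
       ennreal (exp (- (s - t)\<^sup>2 / (8 * \<sigma>\<^sup>2))) * ennreal (normal_density ((s + t) / 2) \<sigma> x)"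
      by (simp add: ennreal_mult[symmetric] entry_ratio_nonneg)
  qed
  also have "\<dots> = ennreal (exp (- (s - t)\<^sup>2 / (8 * \<sigma>\<^sup>2)))"
    using assms by (simp add: nn_integral_cmult nn_integral_normal_density)
  finally show ?thesis
    using assms
    by (simp add: nn_integral_entry_law entry_ratio_def[of _ _ _ 0] ennreal_mult ennreal_plus)
qed

section \<open>Product structure of the law of \<open>Y\<close>\<close>

lemma indicator_PiE_eq_prod:
  assumes "finite I" "y \<in> extensional I"
  shows "indicator (Pi\<^sub>E I A) y = (\<Prod>i\<in>I. indicator (A i) (y i) :: ennreal)"
proof (cases "\<forall>i\<in>I. y i \<in> A i")
  case True
  then have "(\<Prod>i\<in>I. indicator (A i) (y i) :: ennreal) = 1"
    by (intro prod.neutral) auto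
  moreover have "y \<in> Pi\<^sub>E I A" using True assms by (auto simp: PiE_iff)
  ultimately show ?thesis by simp
next
  case False
  then have "(\<Prod>i\<in>I. indicator (A i) (y i) :: ennreal) = 0"
    using assms by (intro prod_zero) (auto simp: indicator_eq_0_iff)
  moreover have "y \<notin> Pi\<^sub>E I A" using False by auto
  ultimately show ?thesis by simp
qed

text \<open>The entries of \<open>Y\<close> are independent because masks and noises are. It
  suffices to compare boxes: the indicator of a box is integrated first over the noise and then over
  the mask, and the integral factorises both times.\<close>

lemma completion_law_eq_PiM:
  assumes "0 < p" "p \<le> 1" "\<sigma> > 0"
  shows "completion_law n m p \<sigma> \<theta> = PiM (entries n m) (\<lambda>ij. entry_law p \<sigma> (\<theta> $$ ij))"
proof -
  let ?I = "entries n m" and ?N = "density lborel (normal_density 0 \<sigma>)"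
    and ?B = "measure_pmf (bernoulli_pmf p)"
  interpret N: prob_space ?N
    using assms by (intro prob_space_normal_density)
  interpret PN: product_prob_space "\<lambda>_. ?N" ?I ..
  interpret PB: product_prob_space "\<lambda>_. ?B" ?I ..
  interpret PP: pair_prob_space "PiM ?I (\<lambda>_. ?B)" "PiM ?I (\<lambda>_. ?N)" ..
  interpret E: prob_space "entry_law p \<sigma> t" for t
    using assms by (intro prob_space_entry_law)
  interpret PE: product_prob_space "\<lambda>ij. entry_law p \<sigma> (\<theta> $$ ij)" ?I ..
  show ?thesis
  proof (rule PE.PiM_eqI)
    show "sets (completion_law n m p \<sigma> \<theta>) = sets (PiM ?I (\<lambda>ij. entry_law p \<sigma> (\<theta> $$ ij)))"
      unfolding completion_law_def sets_distr by (rule sets_PiM_cong) auto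
  next
    fix A assume A: "\<And>ij. ij \<in> ?I \<Longrightarrow> A ij \<in> sets (entry_law p \<sigma> (\<theta> $$ ij))"
    let ?f = "\<lambda>ij e x. indicator (A ij) (of_bool e * (\<theta> $$ ij + x)) :: ennreal"
    have f [measurable]: "(\<lambda>(e, x). ?f ij e x) \<in> borel_measurable (?B \<Otimes>\<^sub>M ?N)" if "ij \<in> ?I" for ij
    proof -
      have [measurable]: "A ij \<in> sets borel" using A that by simp
      show ?thesis unfolding case_prod_beta by measurable
    qed
    have m1: "?f ij e \<in> borel_measurable ?N" if "ij \<in> ?I" for ij e
      using measurable_compose[OF measurable_Pair1'[of e ?B ?N] f[OF that]] by simp
    have AP: "Pi\<^sub>E ?I A \<in> sets (obs_space n m)"
      using A by (intro sets_PiM_I_finite) auto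
    have mm: "(\<lambda>w. \<Prod>ij\<in>?I. ?f ij (fst w ij) (snd w ij)) \<in> borel_measurable (mask_noise n m p \<sigma>)"
    proof (intro borel_measurable_prod_ennreal)
      fix ij assume ij: "ij \<in> ?I"
      have "(\<lambda>w. (fst w ij, snd w ij)) \<in> measurable (mask_noise n m p \<sigma>) (?B \<Otimes>\<^sub>M ?N)"
        unfolding mask_noise_def using ij by measurable
      from measurable_compose[OF this f[OF ij]]
      show "(\<lambda>w. ?f ij (fst w ij) (snd w ij)) \<in> borel_measurable (mask_noise n m p \<sigma>)"
        by simp
    qed
    have "emeasure (completion_law n m p \<sigma> \<theta>) (Pi\<^sub>E ?I A) =
      (\<integral>\<^sup>+ w. indicator (Pi\<^sub>E ?I A) (observation n m \<theta> w) \<partial>mask_noise n m p \<sigma>)"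
      unfolding completion_law_def
      using AP nn_integral_distr[OF measurable_observation[of n m \<theta> p \<sigma>], of "indicator (Pi\<^sub>E ?I A)"]
      by simp
    also have "\<dots> = (\<integral>\<^sup>+ w. (\<Prod>ij\<in>?I. ?f ij (fst w ij) (snd w ij)) \<partial>mask_noise n m p \<sigma>)"
    proof (rule nn_integral_cong)
      fix w
      have "observation n m \<theta> w \<in> extensional ?I"
        by (simp add: observation_def case_prod_beta)
      then show "indicator (Pi\<^sub>E ?I A) (observation n m \<theta> w) = (\<Prod>ij\<in>?I. ?f ij (fst w ij) (snd w ij))"
        by (subst indicator_PiE_eq_prod) (auto simp: observation_def case_prod_beta intro!: prod.cong)
    qed
    also have "\<dots> = (\<integral>\<^sup>+ E. \<integral>\<^sup>+ \<xi>. (\<Prod>ij\<in>?I. ?f ij (E ij) (\<xi> ij)) \<partial>PiM ?I (\<lambda>_. ?N) \<partial>PiM ?I (\<lambda>_. ?B))"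
      using mm unfolding mask_noise_def by (subst PN.nn_integral_fst[symmetric]) auto
    also have "\<dots> = (\<integral>\<^sup>+ E. (\<Prod>ij\<in>?I. \<integral>\<^sup>+ x. ?f ij (E ij) x \<partial>?N) \<partial>PiM ?I (\<lambda>_. ?B))"
      using m1 by (intro nn_integral_cong PN.product_nn_integral_prod) auto
    also have "\<dots> = (\<Prod>ij\<in>?I. \<integral>\<^sup>+ e. \<integral>\<^sup>+ x. ?f ij e x \<partial>?N \<partial>?B)"
      by (intro PB.product_nn_integral_prod) auto
    also have "\<dots> = (\<Prod>ij\<in>?I. emeasure (entry_law p \<sigma> (\<theta> $$ ij)) (A ij))"
    proof (rule prod.cong[OF refl])
      fix ij assume ij: "ij \<in> ?I"
      have [measurable]: "A ij \<in> sets borel" using A ij by simp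
      have "emeasure (entry_law p \<sigma> (\<theta> $$ ij)) (A ij) =
        (\<integral>\<^sup>+ z. ?f ij (fst z) (snd z) \<partial>(?B \<Otimes>\<^sub>M ?N))"
        unfolding entry_law_def
        using nn_integral_distr[OF measurable_masked_shift[where p=p and \<sigma>=\<sigma> and t="\<theta> $$ ij"],
          of "indicator (A ij)"]
        by (simp add: case_prod_beta)
      also have "\<dots> = (\<integral>\<^sup>+ e. \<integral>\<^sup>+ x. ?f ij e x \<partial>?N \<partial>?B)"
        by (subst N.nn_integral_fst[symmetric]) auto
      finally show "(\<integral>\<^sup>+ e. \<integral>\<^sup>+ x. ?f ij e x \<partial>?N \<partial>?B) = emeasure (entry_law p \<sigma> (\<theta> $$ ij)) (A ij)" ..
    qed
    finally show "emeasure (completion_law n m p \<sigma> \<theta>) (Pi\<^sub>E ?I A) =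
        (\<Prod>ij\<in>?I. emeasure (entry_law p \<sigma> (\<theta> $$ ij)) (A ij))" .
  qed simp
qed

section \<open>Testing two signals with a given affinity\<close>

text \<open>Le Cam's bound: the two errors add up to at least the integral of
  \<open>min 1 L\<close>. The hypothesis on the affinity makes this at least
  \<open>15/8 * 7/8 - 2 * 9/16 = 33/64\<close>.\<close>

lemma (in prob_space) testing_affinity:
  fixes L :: "'a \<Rightarrow> real"
  assumes [measurable]: "L \<in> borel_measurable M" "A \<in> sets M"
    and nonneg: "\<And>x. L x \<ge> 0"
    and total: "(\<integral>\<^sup>+ x. ennreal (L x) \<partial>M) = 1"
    and affinity: "(\<integral>\<^sup>+ x. ennreal (sqrt (L x)) \<partial>M) \<ge> ennreal (7 / 8)"
  shows "measure M A + measure (density M L) (space M - A) \<ge> 1 / 2"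
proof -
  have iL: "integrable M L"
    using total nonneg by (intro integrableI_nonneg) auto
  have iA: "integrable M (indicator A :: 'a \<Rightarrow> real)"
    by (rule integrable_real_indicator) (auto simp: emeasure_eq_measure)
  have L1: "(\<integral>x. L x \<partial>M) = 1"
    using total nonneg by (subst integral_eq_nn_integral) auto
  have ir: "integrable M (\<lambda>x. sqrt (L x))"
  proof (rule Bochner_Integration.integrable_bound[of _ "\<lambda>x. 1 + L x"])
    have "sqrt (L x) \<le> 1 + L x" for x
    proof -
      have "0 \<le> (sqrt (L x) - 1)\<^sup>2 + sqrt (L x)" using nonneg[of x] by simp
      then show ?thesis using nonneg[of x] by (simp add: power2_eq_square algebra_simps)
    qed
    then show "AE x in M. norm (sqrt (L x)) \<le> norm (1 + L x)"
      using nonneg by (auto simp: abs_of_nonneg)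
  qed (use iL in auto)
  have r: "(\<integral>x. sqrt (L x) \<partial>M) \<ge> 7 / 8"
    using affinity nonneg ir by (simp add: nn_integral_eq_integral integral_nonneg)
  have "measure (density M L) (space M - A) = (\<integral>x. L x * indicator (space M - A) x \<partial>M)"
    using nonneg unfolding measure_def
    by (subst emeasure_density)
      (auto simp: integral_eq_nn_integral ennreal_mult' ennreal_indicator)
  moreover have "measure M A = (\<integral>x. indicator A x \<partial>M)" by simp
  moreover have "(\<integral>x. indicator A x + L x * indicator (space M - A) x \<partial>M) \<ge>
      (\<integral>x. 15 / 8 * sqrt (L x) - 9 / 16 * (1 + L x) \<partial>M)"
  proof (rule integral_mono)
    fix x assume x: "x \<in> space M"
    define q where "q = sqrt (L x)"
    have q: "L x = q\<^sup>2" using nonneg by (simp add: q_def)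
    \<comment> \<open>The tangent-type bound \<open>15 q / 8 - 9 (1 + q\<^sup>2) / 16 \<le> min 1 q\<^sup>2\<close> makes the total error linear
      in the affinity.\<close>
    have "(5 * q - 3)\<^sup>2 \<ge> 0" "(3 * q - 5)\<^sup>2 \<ge> 0" by simp_all
    moreover have "(5 * q - 3)\<^sup>2 = 25 * q\<^sup>2 - 30 * q + 9" "(3 * q - 5)\<^sup>2 = 9 * q\<^sup>2 - 30 * q + 25"
      by (simp_all add: power2_eq_square algebra_simps)
    ultimately have "15 / 8 * q - 9 / 16 * (1 + q\<^sup>2) \<le> 1" "15 / 8 * q - 9 / 16 * (1 + q\<^sup>2) \<le> q\<^sup>2"
      unfolding distrib_left by linarith+
    then have "15 / 8 * q - 9 / 16 * (1 + q\<^sup>2) \<le> indicator A x + q\<^sup>2 * indicator (space M - A) x"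
      using x by (auto simp: indicator_def simp del: distrib_left)
    then show "15 / 8 * sqrt (L x) - 9 / 16 * (1 + L x) \<le>
        indicator A x + L x * indicator (space M - A) x"
      unfolding q_def[symmetric] unfolding q .
  next
    show "integrable M (\<lambda>x. indicator A x + L x * indicator (space M - A) x)"
      using iL iA by (intro Bochner_Integration.integrable_add integrable_real_mult_indicator) auto
  qed (use ir iL in auto)
  ultimately show ?thesis
    using ir iL iA L1 r by (simp add: integrable_real_mult_indicator prob_space)
qed

lemma sqrt_prod: "sqrt (\<Prod>i\<in>I. f i) = (\<Prod>i\<in>I. sqrt (f i))"
  by (induction I rule: infinite_finite_induct) (auto simp: real_sqrt_mult)

text \<open>Weierstrass's product inequality. It allows the losses of affinity at the single entries
  to be added up.\<close>

lemma prod_one_minus_ge: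
  fixes x :: "'a \<Rightarrow> real"
  assumes "finite I" "\<And>i. i \<in> I \<Longrightarrow> 0 \<le> x i \<and> x i \<le> 1"
  shows "(\<Prod>i\<in>I. 1 - x i) \<ge> 1 - (\<Sum>i\<in>I. x i)"
  using assms
proof (induction I rule: finite_induct)
  case (insert i I)
  have "(1 - x i) * (\<Prod>j\<in>I. 1 - x j) \<ge> (\<Prod>j\<in>I. 1 - x j) - x i"
  proof -
    have "(\<Prod>j\<in>I. 1 - x j) \<le> 1" using insert.prems by (intro prod_le_1) auto
    then have "x i * (\<Prod>j\<in>I. 1 - x j) \<le> x i * 1"
      using insert.prems by (intro mult_left_mono) auto
    then show ?thesis by (simp add: algebra_simps)
  qed
  then show ?case using insert by simp
qed simp

lemma sets_completion_law [simp, measurable_cong]: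
  "sets (completion_law n m p \<sigma> \<theta>) = sets (obs_space n m)"
  by (simp add: completion_law_def)

lemma space_completion_law [simp]: "space (completion_law n m p \<sigma> \<theta>) = space (obs_space n m)"
  by (simp add: completion_law_def)

context
  fixes n m :: nat and p \<sigma> :: real
  assumes p: "0 < p" "p \<le> 1" and sigma: "\<sigma> > 0"
begin

lemma completion_law_density:
  "completion_law n m p \<sigma> \<theta>' = density (completion_law n m p \<sigma> \<theta>)
     (\<lambda>y. ennreal (\<Prod>ij\<in>entries n m. entry_ratio \<sigma> (\<theta> $$ ij) (\<theta>' $$ ij) (y ij)))"
proof -
  let ?I = "entries n m" and ?P = "\<lambda>\<theta> ij. entry_law p \<sigma> (\<theta> $$ ij)"
    and ?r = "\<lambda>ij. entry_ratio \<sigma> (\<theta> $$ ij) (\<theta>' $$ ij)"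
  interpret E: prob_space "entry_law p \<sigma> t" for t
    using sigma by (rule prob_space_entry_law)
  interpret P: product_prob_space "?P \<theta>" ?I ..
  interpret P': product_prob_space "?P \<theta>'" ?I ..
  have "density (PiM ?I (?P \<theta>)) (\<lambda>y. ennreal (\<Prod>ij\<in>?I. ?r ij (y ij))) = PiM ?I (?P \<theta>')"
  proof (rule P'.PiM_eqI)
    show "sets (density (PiM ?I (?P \<theta>)) (\<lambda>y. ennreal (\<Prod>ij\<in>?I. ?r ij (y ij)))) = sets (PiM ?I (?P \<theta>'))"
      unfolding sets_density by (rule sets_PiM_cong) auto
  next
    fix A assume A: "\<And>ij. ij \<in> ?I \<Longrightarrow> A ij \<in> sets (?P \<theta>' ij)"
    then have [measurable]: "A ij \<in> sets borel" if "ij \<in> ?I" for ij using that by simp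
    have AP: "Pi\<^sub>E ?I A \<in> sets (PiM ?I (?P \<theta>))"
      using A by (intro sets_PiM_I_finite) auto
    have "emeasure (density (PiM ?I (?P \<theta>)) (\<lambda>y. ennreal (\<Prod>ij\<in>?I. ?r ij (y ij)))) (Pi\<^sub>E ?I A) =
      (\<integral>\<^sup>+ y. ennreal (\<Prod>ij\<in>?I. ?r ij (y ij)) * indicator (Pi\<^sub>E ?I A) y \<partial>PiM ?I (?P \<theta>))"
      using AP by (intro emeasure_density) measurable
    also have "\<dots> = (\<integral>\<^sup>+ y. (\<Prod>ij\<in>?I. ennreal (?r ij (y ij)) * indicator (A ij) (y ij)) \<partial>PiM ?I (?P \<theta>))"
    proof (rule nn_integral_cong)
      fix y assume y: "y \<in> space (PiM ?I (?P \<theta>))"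
      have "y \<in> extensional ?I" using y by (simp add: space_PiM PiE_def)
      then show "ennreal (\<Prod>ij\<in>?I. ?r ij (y ij)) * indicator (Pi\<^sub>E ?I A) y =
          (\<Prod>ij\<in>?I. ennreal (?r ij (y ij)) * indicator (A ij) (y ij))"
        by (simp add: indicator_PiE_eq_prod prod.distrib prod_ennreal entry_ratio_nonneg)
    qed
    also have "\<dots> = (\<Prod>ij\<in>?I. \<integral>\<^sup>+ x. ennreal (?r ij x) * indicator (A ij) x \<partial>?P \<theta> ij)"
      by (intro P.product_nn_integral_prod) auto
    also have "\<dots> = (\<Prod>ij\<in>?I. emeasure (?P \<theta>' ij) (A ij))"
      using A by (intro prod.cong refl) (subst nn_integral_entry_ratio, use p sigma in auto)
    finally show "emeasure (density (PiM ?I (?P \<theta>)) (\<lambda>y. ennreal (\<Prod>ij\<in>?I. ?r ij (y ij)))) (Pi\<^sub>E ?I A) =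
      (\<Prod>ij\<in>?I. emeasure (?P \<theta>' ij) (A ij))" .
  qed simp
  then show ?thesis
    using p sigma by (simp add: completion_law_eq_PiM)
qed

text \<open>The affinity of product laws is the product of the affinities. Since
  \<open>exp (- u) \<ge> 1 - u\<close>, an entry with difference \<open>x\<close> loses at most
  \<open>p * x^2 / (8 * \<sigma>^2)\<close>, so a total squared distance of
  \<open>\<sigma>^2 / p\<close> costs at most \<open>1 / 8\<close>.\<close>

lemma completion_law_affinity:
  assumes "(\<Sum>ij\<in>entries n m. (\<theta> $$ ij - \<theta>' $$ ij)\<^sup>2) \<le> \<sigma>\<^sup>2 / p"
  shows "(\<integral>\<^sup>+ y. ennreal (sqrt (\<Prod>ij\<in>entries n m. entry_ratio \<sigma> (\<theta> $$ ij) (\<theta>' $$ ij) (y ij)))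
    \<partial>completion_law n m p \<sigma> \<theta>) \<ge> ennreal (7 / 8)"
proof -
  let ?I = "entries n m" and ?P = "\<lambda>ij. entry_law p \<sigma> (\<theta> $$ ij)"
    and ?r = "\<lambda>ij. entry_ratio \<sigma> (\<theta> $$ ij) (\<theta>' $$ ij)"
    and ?h = "\<lambda>ij. 1 - p + p * exp (- (\<theta> $$ ij - \<theta>' $$ ij)\<^sup>2 / (8 * \<sigma>\<^sup>2))"
  interpret E: prob_space "entry_law p \<sigma> t" for t
    using sigma by (rule prob_space_entry_law)
  interpret P: product_prob_space ?P ?I ..
  have h: "0 \<le> 1 - ?h ij \<and> 1 - ?h ij \<le> 1 \<and> 1 - ?h ij \<le> p * ((\<theta> $$ ij - \<theta>' $$ ij)\<^sup>2 / (8 * \<sigma>\<^sup>2))" for ij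
  proof -
    define u where "u = (\<theta> $$ ij - \<theta>' $$ ij)\<^sup>2 / (8 * \<sigma>\<^sup>2)"
    have "u \<ge> 0" by (simp add: u_def)
    have "p * (1 - exp (- u)) \<le> p * u"
      using p exp_ge_add_one_self[of "- u"] by (intro mult_left_mono) auto
    moreover have "p * exp (- u) \<le> p * 1" using p \<open>u \<ge> 0\<close> by (intro mult_left_mono) auto
    moreover have "p * exp (- u) \<ge> 0" using p by simp
    ultimately have "0 \<le> 1 - (1 - p + p * exp (- u)) \<and> 1 - (1 - p + p * exp (- u)) \<le> 1 \<and>
        1 - (1 - p + p * exp (- u)) \<le> p * u"
      using p unfolding right_diff_distrib by linarith
    then show ?thesis by (simp add: u_def)
  qed
  have "7 / 8 \<le> 1 - (\<Sum>ij\<in>?I. 1 - ?h ij)"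
  proof -
    have "(\<Sum>ij\<in>?I. 1 - ?h ij) \<le> (\<Sum>ij\<in>?I. p * ((\<theta> $$ ij - \<theta>' $$ ij)\<^sup>2 / (8 * \<sigma>\<^sup>2)))"
      using h by (intro sum_mono) auto
    also have "\<dots> = p / (8 * \<sigma>\<^sup>2) * (\<Sum>ij\<in>?I. (\<theta> $$ ij - \<theta>' $$ ij)\<^sup>2)"
      by (simp add: sum_distrib_left)
    also have "\<dots> \<le> p / (8 * \<sigma>\<^sup>2) * (\<sigma>\<^sup>2 / p)"
      using assms p by (intro mult_left_mono) auto
    also have "\<dots> = 1 / 8" using p sigma by simp
    finally show ?thesis by simp
  qed
  also have "\<dots> \<le> (\<Prod>ij\<in>?I. 1 - (1 - ?h ij))"
    using h by (intro prod_one_minus_ge) auto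
  also have "\<dots> = (\<Prod>ij\<in>?I. ?h ij)"
    by (intro prod.cong refl) simp
  finally have "ennreal (7 / 8) \<le> ennreal (\<Prod>ij\<in>?I. ?h ij)"
    by (rule ennreal_leI)
  also have "\<dots> = (\<Prod>ij\<in>?I. ennreal (?h ij))"
    using p by (subst prod_ennreal) (auto intro!: add_nonneg_nonneg)
  also have "\<dots> = (\<Prod>ij\<in>?I. \<integral>\<^sup>+ x. ennreal (sqrt (?r ij x)) \<partial>?P ij)"
    using p sigma by (simp add: nn_integral_sqrt_entry_ratio)
  also have "\<dots> = (\<integral>\<^sup>+ y. (\<Prod>ij\<in>?I. ennreal (sqrt (?r ij (y ij)))) \<partial>PiM ?I ?P)"
    by (intro P.product_nn_integral_prod[symmetric]) auto
  also have "\<dots> = (\<integral>\<^sup>+ y. ennreal (sqrt (\<Prod>ij\<in>?I. ?r ij (y ij))) \<partial>completion_law n m p \<sigma> \<theta>)"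
    using p sigma
    by (simp add: completion_law_eq_PiM prod_ennreal entry_ratio_nonneg sqrt_prod)
  finally show ?thesis .
qed

text \<open>Signals this close have affinity at least \<open>7 / 8\<close>, so
  \<open>testing_affinity\<close> applies to their likelihood ratio. The event \<open>A\<close> is
  read as rejecting \<open>\<theta>\<close>.\<close>

lemma completion_law_testing:
  assumes "(\<Sum>ij\<in>entries n m. (\<theta> $$ ij - \<theta>' $$ ij)\<^sup>2) \<le> \<sigma>\<^sup>2 / p" "A \<in> sets (obs_space n m)"
  shows "measure (completion_law n m p \<sigma> \<theta>) A +
    measure (completion_law n m p \<sigma> \<theta>') (space (obs_space n m) - A) \<ge> 1 / 2"
proof -
  let ?L = "\<lambda>y. \<Prod>ij\<in>entries n m. entry_ratio \<sigma> (\<theta> $$ ij) (\<theta>' $$ ij) (y ij)"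
  interpret P: prob_space "completion_law n m p \<sigma> \<theta>"
    using sigma by (rule prob_space_completion_law)
  interpret P': prob_space "completion_law n m p \<sigma> \<theta>'"
    using sigma by (rule prob_space_completion_law)
  have [measurable]: "?L \<in> borel_measurable (completion_law n m p \<sigma> \<theta>)"
    by measurable
  have "(\<integral>\<^sup>+ y. ennreal (?L y) \<partial>completion_law n m p \<sigma> \<theta>) = 1"
    using P'.emeasure_space_1 unfolding completion_law_density[of \<theta>' \<theta>]
    by (subst (asm) emeasure_density) (auto cong: nn_integral_cong_simp)
  then show ?thesis
    using P.testing_affinity[of ?L A] assms completion_law_affinity[of \<theta> \<theta>']
    by (simp add: prod_nonneg entry_ratio_nonneg completion_law_density[of \<theta>' \<theta>, symmetric])
qed

end

section \<open>Cubes of signals\<close>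

text \<open>\<open>g\<close> assigns to every entry the bit that controls it; entries with \<open>g ij \<notin> G\<close> are constant on
  the cube.\<close>

definition contains_cube :: "nat \<Rightarrow> nat \<Rightarrow> real \<Rightarrow> real mat set \<Rightarrow> nat \<Rightarrow> bool" where
  "contains_cube n m v \<Theta> N \<longleftrightarrow>
     (\<exists>(G :: (nat \<times> nat) set) (g :: nat \<times> nat \<Rightarrow> nat \<times> nat) (a :: nat \<times> nat \<Rightarrow> real) (\<delta> :: nat \<times> nat \<Rightarrow> real).
        finite G \<and> card G = N \<and>
        (\<forall>l\<in>G. (\<Sum>ij\<in>{ij \<in> entries n m. g ij = l}. (\<delta> ij)\<^sup>2) = v) \<and>
        (\<forall>S\<subseteq>G. mat n m (\<lambda>ij. a ij + of_bool (g ij \<in> S) * \<delta> ij) \<in> \<Theta>))"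

section \<open>Assouad's argument on a cube, and the passage to the risk\<close>

lemma frobenius_norm_minus:
  assumes "A \<in> carrier_mat n m" "B \<in> carrier_mat n m"
  shows "(frobenius_norm (A - B))\<^sup>2 = (\<Sum>ij\<in>entries n m. (A $$ ij - B $$ ij)\<^sup>2)"
proof -
  have "(frobenius_norm (A - B))\<^sup>2 = (\<Sum>i<n. \<Sum>j<m. ((A - B) $$ (i, j))\<^sup>2)"
    using assms unfolding frobenius_norm_def by (simp add: sum_nonneg)
  also have "\<dots> = (\<Sum>i<n. \<Sum>j<m. (A $$ (i, j) - B $$ (i, j))\<^sup>2)"
    using assms by (intro sum.cong refl arg_cong[where f="\<lambda>x. x\<^sup>2"] index_minus_mat(1)) auto
  finally show ?thesis by (simp add: sum.cartesian_product case_prod_eta)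
qed

lemma borel_measurable_loss:
  assumes "T \<in> estimators n m" "\<theta> \<in> carrier_mat n m"
  shows "(\<lambda>y. (frobenius_norm (T y - \<theta>))\<^sup>2) \<in> borel_measurable (obs_space n m)"
proof -
  have "(\<lambda>y. \<Sum>ij\<in>entries n m. (T y $$ ij - \<theta> $$ ij)\<^sup>2) \<in> borel_measurable (obs_space n m)"
    using assms(1) unfolding estimators_def
    by (intro borel_measurable_sum borel_measurable_power borel_measurable_diff) auto
  then show ?thesis
    by (rule measurable_cong[THEN iffD1, rotated])
      (use assms in \<open>auto simp: estimators_def frobenius_norm_minus\<close>)
qed

text \<open>Pairs the two ends of every edge of the cube in direction \<open>l\<close>, so that
  bounds for neighbours can be summed over all vertices.\<close>

lemma sum_Pow_split:
  fixes f :: "'a set \<Rightarrow> 'b :: comm_monoid_add"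
  assumes "finite G" "l \<in> G"
  shows "(\<Sum>S\<in>Pow G. f S) = (\<Sum>S\<in>Pow (G - {l}). f S + f (insert l S))"
proof -
  have eq: "Pow G = Pow (G - {l}) \<union> insert l ` Pow (G - {l})"
    using assms Pow_insert[of l "G - {l}"] by (simp add: insert_absorb)
  have "inj_on (insert l) (Pow (G - {l}))"
    by (auto simp: inj_on_def)
  then show ?thesis
    unfolding eq using assms
    by (subst sum.union_disjoint) (auto simp: sum.reindex sum.distrib)
qed

text \<open>Assouad's argument, in probability. Averaged over the cube, at least
  \<open>N / 4\<close> bits are decoded wrongly. A loss below \<open>t\<close> leaves at most
  \<open>3 * N / 20\<close> wrong bits, and there are never more than \<open>N\<close>; a
  probability of large loss below \<open>1 / 10\<close> at every vertex would thus give fewer than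
  \<open>3 * N / 20 + N / 10 = N / 4\<close> on average.\<close>

lemma cube_minimax_prob:
  assumes p: "0 < p" "p \<le> 1" and sigma: "\<sigma> > 0"
    and cube: "contains_cube n m (\<sigma>\<^sup>2 / p) \<Theta> N" and N: "N \<ge> 1"
    and t: "t \<le> 3 / 80 * (\<sigma>\<^sup>2 / p) * real N"
  shows "minimax_prob n m p \<sigma> \<Theta> t \<ge> ennreal 0.1"
  unfolding minimax_prob_def
proof (rule INF_greatest)
  fix T assume T: "T \<in> estimators n m"
  define v where "v = \<sigma>\<^sup>2 / p"
  have v: "v > 0" using p sigma by (simp add: v_def)
  from cube obtain G :: "(nat \<times> nat) set" and g :: "nat \<times> nat \<Rightarrow> nat \<times> nat"
    and a \<delta> :: "nat \<times> nat \<Rightarrow> real" where "finite G \<and> card G = N \<and>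
      (\<forall>l\<in>G. (\<Sum>ij\<in>{ij \<in> entries n m. g ij = l}. (\<delta> ij)\<^sup>2) = v) \<and>
      (\<forall>S\<subseteq>G. mat n m (\<lambda>ij. a ij + of_bool (g ij \<in> S) * \<delta> ij) \<in> \<Theta>)"
    unfolding contains_cube_def v_def by (elim exE)
  then have G: "finite G" "card G = N"
    and \<delta>: "\<And>l. l \<in> G \<Longrightarrow> (\<Sum>ij\<in>{ij \<in> entries n m. g ij = l}. (\<delta> ij)\<^sup>2) = v"
    and mem: "\<And>S. S \<subseteq> G \<Longrightarrow> mat n m (\<lambda>ij. a ij + of_bool (g ij \<in> S) * \<delta> ij) \<in> \<Theta>"
    by simp_all
  define \<theta> where "\<theta> S = mat n m (\<lambda>ij. a ij + of_bool (g ij \<in> S) * \<delta> ij)" for S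
  have \<theta>: "\<theta> S \<in> carrier_mat n m" "\<And>ij. ij \<in> entries n m \<Longrightarrow> \<theta> S $$ ij = a ij + of_bool (g ij \<in> S) * \<delta> ij" for S
    by (auto simp: \<theta>_def)
  let ?\<Omega> = "space (obs_space n m)" and ?P = "\<lambda>S. completion_law n m p \<sigma> (\<theta> S)"
    and ?E = "\<lambda>l. {ij \<in> entries n m. g ij = l}"
  \<comment> \<open>\<open>D l b\<close> is the squared distance, on the block of bit
    \<open>l\<close>, between \<open>T\<close> and the signal with this bit set to \<open>b\<close>.
    The decoder picks the nearer value, \<open>True\<close> in a tie; \<open>A l\<close> is the
    event that it picks \<open>True\<close>.\<close>
  define D where "D l b y = (\<Sum>ij\<in>?E l. (T y $$ ij - (a ij + of_bool b * \<delta> ij))\<^sup>2)" for l b y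
  define A where "A l = {y \<in> ?\<Omega>. D l True y \<le> D l False y}" for l
  define Err where "Err S l = (if l \<in> S then ?\<Omega> - A l else A l)" for S l
  define W where "W S = {y \<in> ?\<Omega>. (frobenius_norm (T y - \<theta> S))\<^sup>2 \<ge> t}" for S
  interpret P: prob_space "?P S" for S
    using sigma by (rule prob_space_completion_law)
  have [measurable]: "D l b \<in> borel_measurable (obs_space n m)" for l b
    unfolding D_def using T
    by (intro borel_measurable_sum borel_measurable_power borel_measurable_diff) (auto simp: estimators_def)
  have A [measurable]: "A l \<in> sets (obs_space n m)" for l
    unfolding A_def by measurable
  have Err: "Err S l \<in> sets (obs_space n m)" for S l
    unfolding Err_def by auto
  have W: "W S \<in> sets (obs_space n m)" for S
    unfolding W_def using borel_measurable_loss[OF T \<theta>(1)] by measurable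
  \<comment> \<open>No estimate is close to both values of a bit: the two squared distances add up
    to at least \<open>v / 2\<close>, and on an error the true value is at least as far away as the
    wrong one.\<close>
  have D_err: "D l (l \<in> S) y \<ge> v / 4" if "l \<in> G" "y \<in> Err S l" for S l y
  proof -
    have "v / 2 = (\<Sum>ij\<in>?E l. (\<delta> ij)\<^sup>2 / 2)"
      using \<delta>[OF that(1)] by (simp add: sum_divide_distrib[symmetric])
    also have "\<dots> \<le> (\<Sum>ij\<in>?E l. (T y $$ ij - (a ij + of_bool True * \<delta> ij))\<^sup>2 +
        (T y $$ ij - (a ij + of_bool False * \<delta> ij))\<^sup>2)"
    proof (rule sum_mono)
      fix ij
      define x where "x = T y $$ ij - a ij"
      have "0 \<le> (2 * x - \<delta> ij)\<^sup>2" by simp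
      also have "(2 * x - \<delta> ij)\<^sup>2 = 2 * ((x - \<delta> ij)\<^sup>2 + x\<^sup>2 - (\<delta> ij)\<^sup>2 / 2)"
        by (simp add: power2_eq_square algebra_simps)
      finally show "(\<delta> ij)\<^sup>2 / 2 \<le> (T y $$ ij - (a ij + of_bool True * \<delta> ij))\<^sup>2 +
        (T y $$ ij - (a ij + of_bool False * \<delta> ij))\<^sup>2"
        by (simp add: x_def diff_diff_eq)
    qed
    also have "\<dots> = D l True y + D l False y"
      by (simp add: D_def sum.distrib)
    finally show ?thesis
      using that(2) by (auto simp: Err_def A_def split: if_splits)
  qed
  have errors: "(\<Sum>l\<in>G. indicator (Err S l) y) \<le> 3 / 20 * real N + real N * indicator (W S) y"
    if y: "y \<in> ?\<Omega>" for S y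
  proof (cases "y \<in> W S")
    case True
    have "(\<Sum>l\<in>G. indicator (Err S l) y) \<le> (\<Sum>l\<in>G. 1 :: real)"
      by (intro sum_mono) (auto simp: indicator_def)
    then show ?thesis using True G by simp
  next
    case False
    have "v / 4 * (\<Sum>l\<in>G. indicator (Err S l) y) = (\<Sum>l\<in>G. v / 4 * indicator (Err S l) y)"
      by (rule sum_distrib_left)
    also have "\<dots> \<le> (\<Sum>l\<in>G. D l (l \<in> S) y)"
    proof (rule sum_mono)
      fix l assume "l \<in> G"
      moreover have "D l (l \<in> S) y \<ge> 0" by (simp add: D_def sum_nonneg)
      ultimately show "v / 4 * indicator (Err S l) y \<le> D l (l \<in> S) y"
        using D_err[of l y S] by (auto simp: indicator_def)
    qed
    \<comment> \<open>The blocks are disjoint, so the distances add up to a part of the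
      loss.\<close>
    also have "\<dots> = (\<Sum>l\<in>G. \<Sum>ij\<in>?E l. (T y $$ ij - \<theta> S $$ ij)\<^sup>2)"
      unfolding D_def by (intro sum.cong refl) (auto simp: \<theta>)
    also have "\<dots> = (\<Sum>ij\<in>(\<Union>l\<in>G. ?E l). (T y $$ ij - \<theta> S $$ ij)\<^sup>2)"
      using G by (intro sum.UNION_disjoint[symmetric]) auto
    also have "\<dots> \<le> (\<Sum>ij\<in>entries n m. (T y $$ ij - \<theta> S $$ ij)\<^sup>2)"
      by (intro sum_mono2) auto
    also have "\<dots> = (frobenius_norm (T y - \<theta> S))\<^sup>2"
      using T y \<theta>(1) by (subst frobenius_norm_minus) (auto simp: estimators_def)
    also have "\<dots> \<le> 3 / 80 * v * real N"
      using False y t by (simp add: W_def v_def)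
    also have "\<dots> = v / 4 * (3 / 20 * real N)" by simp
    finally have "(\<Sum>l\<in>G. indicator (Err S l) y) \<le> 3 / 20 * real N"
      using v by (subst (asm) mult_le_cancel_left_pos) auto
    then show ?thesis using False by simp
  qed
  have avg: "(\<Sum>l\<in>G. measure (?P S) (Err S l)) \<le> 3 / 20 * real N + real N * measure (?P S) (W S)" for S
  proof -
    have [measurable]: "Err S l \<in> sets (?P S)" "W S \<in> sets (?P S)" for l
      using Err W by simp_all
    have int: "integrable (?P S) (indicator (Err S l) :: _ \<Rightarrow> real)"
      "integrable (?P S) (indicator (W S) :: _ \<Rightarrow> real)" for l
      using Err W by (auto intro!: integrable_real_indicator simp: P.emeasure_eq_measure)
    have space: "Err S l \<inter> ?\<Omega> = Err S l" "W S \<inter> ?\<Omega> = W S" for l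
      using Err W sets.sets_into_space by blast+
    have "(\<Sum>l\<in>G. measure (?P S) (Err S l)) = (\<integral>y. (\<Sum>l\<in>G. indicator (Err S l) y) \<partial>?P S)"
      using int by (subst Bochner_Integration.integral_sum) (simp_all add: space)
    also have "\<dots> \<le> (\<integral>y. 3 / 20 * real N + real N * indicator (W S) y \<partial>?P S)"
      using errors int by (intro integral_mono) auto
    also have "\<dots> = 3 / 20 * real N + real N * measure (?P S) (W S)"
      using int P.prob_space[of S]
      by (subst Bochner_Integration.integral_add) (simp_all add: space)
    finally show ?thesis .
  qed
  \<comment> \<open>The vertices \<open>S\<close> and \<open>insert l S\<close> differ only on the
    block of \<open>l\<close>, by the total squared amount \<open>v\<close>. The same event
    \<open>A l\<close> decides the bit at both ends of the edge, so the decoder is a test between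
    them.\<close>
  have bit: "1 / 2 \<le> measure (?P S) (Err S l) + measure (?P (insert l S)) (Err (insert l S) l)"
    if "l \<in> G" "l \<notin> S" for S l
  proof -
    have "(\<Sum>ij\<in>entries n m. (\<theta> S $$ ij - \<theta> (insert l S) $$ ij)\<^sup>2) =
        (\<Sum>ij\<in>entries n m. if g ij = l then (\<delta> ij)\<^sup>2 else 0)"
      using that by (intro sum.cong refl) (auto simp: \<theta>)
    also have "\<dots> = v"
      using \<delta>[OF that(1)] by (subst sum.inter_filter[symmetric]) auto
    finally show ?thesis
      using that completion_law_testing[OF p sigma, where A="A l" and \<theta>="\<theta> S" and \<theta>'="\<theta> (insert l S)"] A
      by (simp add: Err_def v_def)
  qed
  obtain M where M: "N = Suc M" using N by (cases N) auto
  \<comment> \<open>Each of the \<open>N\<close> bits has \<open>2 ^ M\<close> edges, and each edge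
    contributes at least \<open>1 / 2\<close>.\<close>
  have "2 ^ N * real N / 4 = (\<Sum>l\<in>G. \<Sum>S\<in>Pow (G - {l}). 1 / 2 :: real)"
    using G by (simp add: card_Pow M)
  also have "\<dots> \<le> (\<Sum>l\<in>G. \<Sum>S\<in>Pow (G - {l}).
      measure (?P S) (Err S l) + measure (?P (insert l S)) (Err (insert l S) l))"
    by (intro sum_mono bit) auto
  also have "\<dots> = (\<Sum>l\<in>G. \<Sum>S\<in>Pow G. measure (?P S) (Err S l))"
    using G by (intro sum.cong refl sum_Pow_split[symmetric]) auto
  also have "\<dots> = (\<Sum>S\<in>Pow G. \<Sum>l\<in>G. measure (?P S) (Err S l))"
    by (rule sum.swap)
  finally have *: "2 ^ N * real N / 4 \<le> (\<Sum>S\<in>Pow G. \<Sum>l\<in>G. measure (?P S) (Err S l))" .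
  have "\<exists>S\<in>Pow G. measure (?P S) (W S) \<ge> 0.1"
  proof (rule ccontr)
    assume "\<not> ?thesis"
    then have small: "\<And>S. S \<in> Pow G \<Longrightarrow> measure (?P S) (W S) < 0.1"
      by (meson not_le)
    have "(\<Sum>l\<in>G. measure (?P S) (Err S l)) < real N / 4" if "S \<in> Pow G" for S
    proof -
      have "real N * measure (?P S) (W S) < real N * 0.1"
        using small[OF that] N by (intro mult_strict_left_mono) auto
      then show ?thesis using avg[of S] by simp
    qed
    then have "(\<Sum>S\<in>Pow G. \<Sum>l\<in>G. measure (?P S) (Err S l)) < (\<Sum>S\<in>Pow G. real N / 4)"
      using G by (intro sum_strict_mono) auto
    also have "\<dots> = 2 ^ N * real N / 4"
      using G by (simp add: card_Pow)
    finally show False using * by simp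
  qed
  then obtain S where S: "S \<subseteq> G" "measure (?P S) (W S) \<ge> 0.1" by blast
  have "ennreal 0.1 \<le> emeasure (?P S) (W S)"
    using S by (simp add: P.emeasure_eq_measure ennreal_leI)
  also have "\<dots> \<le> (SUP \<theta>\<in>\<Theta>. emeasure (completion_law n m p \<sigma> \<theta>)
      {y \<in> space (completion_law n m p \<sigma> \<theta>). t \<le> (frobenius_norm (T y - \<theta>))\<^sup>2})"
    using mem[OF S(1)] by (intro SUP_upper2[of "\<theta> S"]) (auto simp: W_def \<theta>_def)
  finally show "ennreal 0.1 \<le> \<dots>" .
qed

text \<open>Markov's inequality for each signal, passed through the supremum and the
  infimum.\<close>

lemma minimax_risk_ge:
  assumes "\<Theta> \<subseteq> carrier_mat n m" "\<sigma> > 0" "t \<ge> 0"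
  shows "ennreal t * minimax_prob n m p \<sigma> \<Theta> t \<le> minimax_risk n m p \<sigma> \<Theta>"
  unfolding minimax_risk_def
proof (rule INF_greatest)
  fix T assume T: "T \<in> estimators n m"
  let ?P = "\<lambda>\<theta>. completion_law n m p \<sigma> \<theta>" and ?l = "\<lambda>\<theta> y. (frobenius_norm (T y - \<theta>))\<^sup>2"
  have "ennreal t * minimax_prob n m p \<sigma> \<Theta> t \<le>
      ennreal t * (SUP \<theta>\<in>\<Theta>. emeasure (?P \<theta>) {y \<in> space (?P \<theta>). t \<le> ?l \<theta> y})"
    unfolding minimax_prob_def using T by (intro mult_left_mono INF_lower) auto
  also have "\<dots> = (SUP \<theta>\<in>\<Theta>. ennreal t * emeasure (?P \<theta>) {y \<in> space (?P \<theta>). t \<le> ?l \<theta> y})"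
    by (rule SUP_mult_left_ennreal)
  also have "\<dots> \<le> (SUP \<theta>\<in>\<Theta>. \<integral>\<^sup>+ y. ennreal (?l \<theta> y) \<partial>?P \<theta>)"
  proof (rule SUP_subset_mono[OF subset_refl])
    fix \<theta> assume "\<theta> \<in> \<Theta>"
    then have [measurable]: "?l \<theta> \<in> borel_measurable (?P \<theta>)"
      using assms borel_measurable_loss[OF T, of \<theta>] by (auto cong: measurable_cong_sets simp: completion_law_def)
    have "ennreal t * emeasure (?P \<theta>) {y \<in> space (?P \<theta>). t \<le> ?l \<theta> y} =
        (\<integral>\<^sup>+ y. ennreal t * indicator {y \<in> space (?P \<theta>). t \<le> ?l \<theta> y} y \<partial>?P \<theta>)"
      by (rule nn_integral_cmult_indicator[symmetric]) measurable
    also have "\<dots> \<le> (\<integral>\<^sup>+ y. ennreal (?l \<theta> y) \<partial>?P \<theta>)"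
      by (intro nn_integral_mono) (auto simp: indicator_def intro: ennreal_leI)
    finally show "ennreal t * emeasure (?P \<theta>) {y \<in> space (?P \<theta>). t \<le> ?l \<theta> y} \<le>
        (\<integral>\<^sup>+ y. ennreal (?l \<theta> y) \<partial>?P \<theta>)" .
  qed
  finally show "ennreal t * minimax_prob n m p \<sigma> \<Theta> t \<le> (SUP \<theta>\<in>\<Theta>. \<integral>\<^sup>+ y. ennreal (?l \<theta> y) \<partial>?P \<theta>)" .
qed

section \<open>Cubes in the structured classes\<close>

definition bilinear_class :: "real mat set \<Rightarrow> real mat set \<Rightarrow> nat \<Rightarrow> nat \<Rightarrow> real mat set" where
  "bilinear_class \<X> \<Z> k l =
     {X * B * transpose_mat Z | X B Z. X \<in> \<X> \<and> B \<in> carrier_mat k l \<and> Z \<in> \<Z>}"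

text \<open>Every row of the selector is a unit vector, so it lies in the exactly sparse classes as well.
  When \<open>n > k\<close> the last column is repeated; the blocks of the bits then differ in size, which the
  weights of the cube compensate.\<close>

definition selector :: "nat \<Rightarrow> nat \<Rightarrow> real mat" where
  "selector n k = mat n k (\<lambda>(i, a). of_bool (a = min i (k - 1)))"

lemma selector_carrier [simp]: "selector n k \<in> carrier_mat n k"
  by (simp add: selector_def)

lemma bilinear_selector_eq:
  assumes "X \<in> carrier_mat n k" "l \<ge> 1"
  shows "X * mat k l (\<lambda>(a, b). \<beta> a b) * transpose_mat (selector m l) =
    mat n m (\<lambda>(i, j). \<Sum>a<k. X $$ (i, a) * \<beta> a (min j (l - 1)))"
proof (rule eq_matI)
  fix i j
  assume "i < dim_row (mat n m (\<lambda>(i, j). \<Sum>a<k. X $$ (i, a) * \<beta> a (min j (l - 1))))"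
    "j < dim_col (mat n m (\<lambda>(i, j). \<Sum>a<k. X $$ (i, a) * \<beta> a (min j (l - 1))))"
  then have ij: "i < n" "j < m" by auto
  have row: "(X * mat k l (\<lambda>(a, b). \<beta> a b)) $$ (i, b) = (\<Sum>a<k. X $$ (i, a) * \<beta> a b)" if "b < l" for b
    using assms ij that by (simp add: scalar_prod_def atLeast0LessThan)
  have "(X * mat k l (\<lambda>(a, b). \<beta> a b) * transpose_mat (selector m l)) $$ (i, j) =
    (\<Sum>b<l. (\<Sum>a<k. X $$ (i, a) * \<beta> a b) * selector m l $$ (j, b))"
    using assms ij row by (simp add: scalar_prod_def atLeast0LessThan selector_def)
  also have "\<dots> = (\<Sum>b<l. if b = min j (l - 1) then (\<Sum>a<k. X $$ (i, a) * \<beta> a b) else 0)"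
    using ij by (intro sum.cong refl) (auto simp: selector_def)
  also have "\<dots> = (\<Sum>a<k. X $$ (i, a) * \<beta> a (min j (l - 1)))"
    using assms by (subst sum.delta) auto
  finally show "(X * mat k l (\<lambda>(a, b). \<beta> a b) * transpose_mat (selector m l)) $$ (i, j) =
      mat n m (\<lambda>(i, j). \<Sum>a<k. X $$ (i, a) * \<beta> a (min j (l - 1))) $$ (i, j)"
    using ij by simp
qed (use assms in \<open>auto simp: selector_def\<close>)

lemma bilinear_classI:
  assumes "X \<in> \<X>" "X \<in> carrier_mat n k" "l \<ge> 1" "selector m l \<in> \<Z>"
    and "\<And>i j. i < n \<Longrightarrow> j < m \<Longrightarrow> f (i, j) = (\<Sum>a<k. X $$ (i, a) * \<beta> a (min j (l - 1)))"
  shows "mat n m f \<in> bilinear_class \<X> \<Z> k l"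
proof -
  have "mat n m f = mat n m (\<lambda>(i, j). \<Sum>a<k. X $$ (i, a) * \<beta> a (min j (l - 1)))"
    using assms(5) by (intro cong_mat) auto
  also have "\<dots> = X * mat k l (\<lambda>(a, b). \<beta> a b) * transpose_mat (selector m l)"
    using assms by (intro bilinear_selector_eq[symmetric])
  finally show ?thesis
    using assms(1,4) unfolding bilinear_class_def
    by (intro CollectI exI[of _ X] exI[of _ "mat k l (\<lambda>(a, b). \<beta> a b)"] exI[of _ "selector m l"]) simp
qed

text \<open>The rows of \<open>selector n k\<close> that point to column \<open>a\<close>. For
  \<open>a < min n k\<close> there is exactly one, except possibly at
  \<open>a = k - 1\<close>.\<close>

definition fiber :: "nat \<Rightarrow> nat \<Rightarrow> nat \<Rightarrow> nat set" where
  "fiber n k a = {i. i < n \<and> min i (k - 1) = a}"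

lemma card_fiber_pos:
  assumes "a < min n k"
  shows "card (fiber n k a) > 0"
proof -
  have "a \<in> fiber n k a" using assms by (auto simp: fiber_def)
  moreover have "finite (fiber n k a)" by (simp add: fiber_def)
  ultimately show ?thesis by (auto simp: card_gt_0_iff)
qed

text \<open>With selectors on both sides the signal consists of entries of \<open>B\<close>, the
  last row and column possibly repeated. Bit \<open>(a, b)\<close> switches one entry of
  \<open>B\<close> between \<open>0\<close> and \<open>w a b\<close>, a weight that spreads the mass
  \<open>v\<close> evenly over the block of the bit.\<close>

lemma contains_cube_core:
  assumes k: "k \<ge> 1" "l \<ge> 1" and sel: "selector n k \<in> \<X>" "selector m l \<in> \<Z>" and v: "v \<ge> 0"
  shows "contains_cube n m v (bilinear_class \<X> \<Z> k l) (min n k * min m l)"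
proof -
  define w where "w a b = sqrt (v / (real (card (fiber n k a)) * real (card (fiber m l b))))" for a b
  define G where "G = {..<min n k} \<times> {..<min m l}"
  define g where "g = (\<lambda>(i, j). (min i (k - 1), min j (l - 1)))"
  define \<delta> where "\<delta> ij = (case g ij of (a, b) \<Rightarrow> w a b)" for ij
  have mass: "(\<Sum>ij\<in>{ij \<in> entries n m. g ij = c}. (\<delta> ij)\<^sup>2) = v" if "c \<in> G" for c
  proof -
    obtain a b where c: "c = (a, b)" "a < min n k" "b < min m l" using \<open>c \<in> G\<close> by (auto simp: G_def)
    have "{ij \<in> entries n m. g ij = c} = fiber n k a \<times> fiber m l b"
      by (auto simp: g_def c fiber_def)
    moreover have "(\<Sum>ij\<in>{ij \<in> entries n m. g ij = c}. (\<delta> ij)\<^sup>2) =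
        (\<Sum>ij\<in>{ij \<in> entries n m. g ij = c}. (w a b)\<^sup>2)"
      by (intro sum.cong refl) (auto simp: \<delta>_def c)
    ultimately show ?thesis
      using v card_fiber_pos[OF c(2)] card_fiber_pos[OF c(3)]
      by (simp add: w_def card_cartesian_product)
  qed
  have mem: "mat n m (\<lambda>ij. 0 + of_bool (g ij \<in> S) * \<delta> ij) \<in> bilinear_class \<X> \<Z> k l"
    if "S \<subseteq> G" for S
  proof (rule bilinear_classI[where \<beta>="\<lambda>a b. of_bool ((a, b) \<in> S) * w a b", OF sel(1) _ k(2) sel(2)])
    fix i j assume ij: "i < n" "j < m"
    have "(\<Sum>a<k. selector n k $$ (i, a) * (of_bool ((a, min j (l - 1)) \<in> S) * w a (min j (l - 1)))) =
      (\<Sum>a<k. if a = min i (k - 1) then of_bool ((a, min j (l - 1)) \<in> S) * w a (min j (l - 1)) else 0)"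
      using ij by (intro sum.cong refl) (auto simp: selector_def)
    also have "\<dots> = of_bool (g (i, j) \<in> S) * \<delta> (i, j)"
      using k by (subst sum.delta) (auto simp: g_def \<delta>_def)
    finally show "0 + of_bool (g (i, j) \<in> S) * \<delta> (i, j) =
      (\<Sum>a<k. selector n k $$ (i, a) * (of_bool ((a, min j (l - 1)) \<in> S) * w a (min j (l - 1))))"
      by simp
  qed simp
  have "finite G" "card G = min n k * min m l"
    by (simp_all add: G_def card_cartesian_product)
  then show ?thesis
    unfolding contains_cube_def
    by (intro exI[of _ G] exI[of _ g] exI[of _ "\<lambda>_. 0"] exI[of _ \<delta>] conjI ballI allI impI mass mem)
qed

text \<open>The offset is needed for \<open>k = s = 1\<close> only, where a bit has to be expressed by two nonzero
  letters.\<close>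

definition encodes :: "real mat set \<Rightarrow> nat \<Rightarrow> nat \<Rightarrow> nat \<Rightarrow> bool" where
  "encodes \<X> n k d \<longleftrightarrow> (\<forall>w :: nat \<Rightarrow> real. \<exists>(\<beta> :: nat \<Rightarrow> nat \<Rightarrow> real) (off :: nat \<Rightarrow> real).
     \<forall>S :: nat \<Rightarrow> nat set. \<exists>X\<in>\<X>. X \<in> carrier_mat n k \<and>
       (\<forall>i<n. \<forall>b. (\<Sum>a<k. X $$ (i, a) * \<beta> a b) = off b + of_bool (b \<in> S i \<and> b < d) * w b))"

text \<open>Only \<open>X\<close> varies, and its row \<open>i\<close> carries the bits
  \<open>(i, b)\<close> with \<open>b < d\<close>. As \<open>encodes\<close> chooses
  \<open>\<beta>\<close> and \<open>off\<close> before the pattern, \<open>B\<close> and the base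
  point are the same at all vertices. The bound on \<open>d\<close> keeps the fibers of the bits
  nonempty.\<close>

lemma contains_cube_factor:
  assumes enc: "encodes \<X> n k d" and d: "d \<le> min m l" and l: "l \<ge> 1"
    and sel: "selector m l \<in> \<Z>" and v: "v \<ge> 0"
  shows "contains_cube n m v (bilinear_class \<X> \<Z> k l) (n * d)"
proof -
  define w where "w b = sqrt (v / real (card (fiber m l b)))" for b
  from enc obtain \<beta> :: "nat \<Rightarrow> nat \<Rightarrow> real" and off :: "nat \<Rightarrow> real" where
    enc': "\<forall>S :: nat \<Rightarrow> nat set. \<exists>X\<in>\<X>. X \<in> carrier_mat n k \<and>
       (\<forall>i<n. \<forall>b. (\<Sum>a<k. X $$ (i, a) * \<beta> a b) = off b + of_bool (b \<in> S i \<and> b < d) * w b)"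
    unfolding encodes_def by blast
  define G where "G = {..<n} \<times> {..<d}"
  define g where "g = (\<lambda>(i :: nat, j). (i, min j (l - 1)))"
  define \<delta> where "\<delta> ij = w (min (snd ij) (l - 1))" for ij :: "nat \<times> nat"
  define a where "a ij = off (min (snd ij) (l - 1))" for ij :: "nat \<times> nat"
  have mass: "(\<Sum>ij\<in>{ij \<in> entries n m. g ij = c}. (\<delta> ij)\<^sup>2) = v" if "c \<in> G" for c
  proof -
    obtain i b where c: "c = (i, b)" "i < n" "b < d" using \<open>c \<in> G\<close> by (auto simp: G_def)
    have "{ij \<in> entries n m. g ij = c} = {i} \<times> fiber m l b"
      using c by (auto simp: g_def fiber_def)
    moreover have "(\<Sum>ij\<in>{ij \<in> entries n m. g ij = c}. (\<delta> ij)\<^sup>2) =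
        (\<Sum>ij\<in>{ij \<in> entries n m. g ij = c}. (w b)\<^sup>2)"
      by (intro sum.cong refl) (auto simp: \<delta>_def g_def c)
    moreover have "card (fiber m l b) > 0"
      using c d by (intro card_fiber_pos) simp
    ultimately show ?thesis
      using v by (simp add: w_def card_cartesian_product)
  qed
  have mem: "mat n m (\<lambda>ij. a ij + of_bool (g ij \<in> S) * \<delta> ij) \<in> bilinear_class \<X> \<Z> k l"
    if "S \<subseteq> G" for S
  proof -
    obtain X where X: "X \<in> \<X>" "X \<in> carrier_mat n k"
      and eq: "\<And>i b. i < n \<Longrightarrow> (\<Sum>a<k. X $$ (i, a) * \<beta> a b) = off b + of_bool (b \<in> {b. (i, b) \<in> S} \<and> b < d) * w b"
      using enc'[rule_format, of "\<lambda>i. {b. (i, b) \<in> S}"] by blast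
    show ?thesis
    proof (rule bilinear_classI[OF X l sel])
      fix i j assume ij: "i < n" "j < m"
      show "a (i, j) + of_bool (g (i, j) \<in> S) * \<delta> (i, j) = (\<Sum>a<k. X $$ (i, a) * \<beta> a (min j (l - 1)))"
        using that unfolding eq[OF ij(1)] by (auto simp: a_def \<delta>_def g_def G_def)
    qed
  qed
  have "finite G" "card G = n * d"
    by (simp_all add: G_def card_cartesian_product)
  then show ?thesis
    unfolding contains_cube_def
    by (intro exI[of _ G] exI[of _ g] exI[of _ a] exI[of _ \<delta>] conjI ballI allI impI mass mem)
qed

text \<open>Swapping the coordinates of the entries leaves bits and masses as they are. This reduces
  the right factor to the left one.\<close>

lemma contains_cube_transpose:
  assumes "contains_cube n m v \<Theta> N" "transpose_mat ` \<Theta> \<subseteq> \<Theta>'"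
  shows "contains_cube m n v \<Theta>' N"
proof -
  from assms(1) obtain G :: "(nat \<times> nat) set" and g :: "nat \<times> nat \<Rightarrow> nat \<times> nat"
    and a \<delta> :: "nat \<times> nat \<Rightarrow> real" where *: "finite G \<and> card G = N \<and>
      (\<forall>l\<in>G. (\<Sum>ij\<in>{ij \<in> entries n m. g ij = l}. (\<delta> ij)\<^sup>2) = v) \<and>
      (\<forall>S\<subseteq>G. mat n m (\<lambda>ij. a ij + of_bool (g ij \<in> S) * \<delta> ij) \<in> \<Theta>)"
    unfolding contains_cube_def by (elim exE)
  define g' a' \<delta>' where "g' = g \<circ> prod.swap" and "a' = a \<circ> prod.swap" and "\<delta>' = \<delta> \<circ> prod.swap"
  have "(\<Sum>ij\<in>{ij \<in> entries m n. g' ij = l}. (\<delta>' ij)\<^sup>2) =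
      (\<Sum>ij\<in>{ij \<in> entries n m. g ij = l}. (\<delta> ij)\<^sup>2)" for l
    by (rule sum.reindex_bij_witness[of _ prod.swap prod.swap]) (auto simp: g'_def \<delta>'_def)
  moreover have "mat m n (\<lambda>ij. a' ij + of_bool (g' ij \<in> S) * \<delta>' ij) \<in> \<Theta>'" if "S \<subseteq> G" for S
  proof -
    have "mat m n (\<lambda>ij. a' ij + of_bool (g' ij \<in> S) * \<delta>' ij) =
        transpose_mat (mat n m (\<lambda>ij. a ij + of_bool (g ij \<in> S) * \<delta> ij))"
      by (rule eq_matI) (auto simp: g'_def a'_def \<delta>'_def)
    then show ?thesis using * that assms(2) by auto
  qed
  ultimately show ?thesis
    using * unfolding contains_cube_def
    by (intro exI[of _ G] exI[of _ g'] exI[of _ a'] exI[of _ \<delta>']) simp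
qed

lemma transpose_bilinear_class:
  assumes "\<X> \<subseteq> carrier_mat n k" "\<Z> \<subseteq> carrier_mat m l"
  shows "transpose_mat ` bilinear_class \<X> \<Z> k l \<subseteq> bilinear_class \<Z> \<X> l k"
proof
  fix A assume "A \<in> transpose_mat ` bilinear_class \<X> \<Z> k l"
  then obtain X B Z where A: "A = transpose_mat (X * B * transpose_mat Z)"
    and mem: "X \<in> \<X>" "B \<in> carrier_mat k l" "Z \<in> \<Z>"
    unfolding bilinear_class_def by auto
  have car: "X \<in> carrier_mat n k" "Z \<in> carrier_mat m l" using mem assms by auto
  have "A = Z * (transpose_mat B * transpose_mat X)"
    unfolding A using car mem
    by (subst transpose_mult[of _ n l _ m]) (auto simp: transpose_mult[of X n k B l])
  also have "\<dots> = Z * transpose_mat B * transpose_mat X"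
    using car mem by (intro assoc_mult_mat[symmetric]) auto
  finally show "A \<in> bilinear_class \<Z> \<X> l k"
    using mem unfolding bilinear_class_def
    by (intro CollectI exI[of _ Z] exI[of _ "transpose_mat B"] exI[of _ X]) simp
qed

section \<open>Codes that write bits into a choice of columns\<close>

text \<open>\<open>\<beta> a\<close> is the set of bits written on column \<open>a\<close>. A row of
  \<open>X\<close> with ones on \<open>A\<close> adds up these labels, so each bit of
  \<open>S\<close> has to be hit exactly once and each other bit below \<open>d\<close> never;
  \<open>P\<close> is the sparsity condition on the row.\<close>

definition bit_code :: "nat \<Rightarrow> nat \<Rightarrow> (nat \<Rightarrow> bool) \<Rightarrow> bool" where
  "bit_code k d P \<longleftrightarrow> (\<exists>\<beta> :: nat \<Rightarrow> nat \<Rightarrow> bool. \<forall>S\<subseteq>{..<d}. \<exists>A\<subseteq>{..<k}.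
     P (card A) \<and> (\<forall>b<d. card {a \<in> A. \<beta> a b} = of_bool (b \<in> S)))"

text \<open>One column has to be chosen even for the empty pattern, so all \<open>2 ^ d\<close>
  subsets, the empty one included, get columns of their own.\<close>

lemma bit_code_singleton:
  assumes "2 ^ d \<le> k"
  shows "bit_code k d (\<lambda>c. c = 1)"
proof -
  obtain e where e: "e ` Pow {..<d} \<subseteq> {..<k}" "inj_on e (Pow {..<d})"
    using card_le_inj[of "Pow {..<d}" "{..<k}"] assms by (auto simp: card_Pow)
  define \<beta> where "\<beta> a b = (\<exists>U\<in>Pow {..<d}. e U = a \<and> b \<in> U)" for a :: nat and b :: nat
  show ?thesis
    unfolding bit_code_def
  proof (intro exI[of _ \<beta>] allI impI)
    fix S :: "nat set" assume S: "S \<subseteq> {..<d}"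
    have "\<beta> (e S) b \<longleftrightarrow> b \<in> S" for b
      using S inj_onD[OF e(2)] unfolding \<beta>_def by blast
    then have "{a \<in> {e S}. \<beta> a b} = (if b \<in> S then {e S} else {})" for b
      by auto
    moreover have "e S \<in> {..<k}" using S e(1) by blast
    ultimately show "\<exists>A\<subseteq>{..<k}. card A = 1 \<and> (\<forall>b<d. card {a \<in> A. \<beta> a b} = of_bool (b \<in> S))"
      by (intro exI[of _ "{e S}"]) auto
  qed
qed

text \<open>The bits are cut into \<open>s\<close> blocks of length \<open>d\<close>, and each
  nonempty subset of a block gets its own column, which takes \<open>s * (2 ^ d - 1)\<close>
  columns. A pattern is the disjoint union of its nonempty traces on the blocks, at most
  \<open>s\<close> in number.\<close>

lemma bit_code_blocks:
  assumes "s * (2 ^ d - 1) \<le> k" "d \<ge> 1"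
  shows "bit_code k (s * d) (\<lambda>c. c \<le> s)"
proof -
  define block where "block l = {l * d..<(l + 1) * d}" for l
  define F where "F = (\<Union>l<s. Pow (block l) - {{}})"
  have "card F \<le> (\<Sum>l<s. card (Pow (block l) - {{}}))"
    unfolding F_def by (intro card_UN_le) simp
  also have "\<dots> = s * (2 ^ d - 1)"
    by (simp add: card_Diff_subset card_Pow block_def)
  finally have "card F \<le> card {..<k}" using assms by simp
  moreover have "finite F" by (auto simp: F_def block_def)
  ultimately obtain e where e: "e ` F \<subseteq> {..<k}" "inj_on e F"
    using card_le_inj[of F "{..<k}"] by auto
  \<comment> \<open>Injectivity of \<open>e\<close> makes \<open>U\<close> the label of column
    \<open>e U\<close>; columns outside the image get the empty label.\<close>
  define \<beta> where "\<beta> a b = (\<exists>U\<in>F. e U = a \<and> b \<in> U)" for a :: nat and b :: nat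
  show ?thesis
    unfolding bit_code_def
  proof (intro exI[of _ \<beta>] allI impI)
    fix S :: "nat set" assume S: "S \<subseteq> {..<s * d}"
    define \<U> where "\<U> = (\<lambda>l. S \<inter> block l) ` {..<s} - {{}}"
    have \<U>: "\<U> \<subseteq> F" by (auto simp: \<U>_def F_def)
    have "card (e ` \<U>) \<le> card ((\<lambda>l. S \<inter> block l) ` {..<s})"
      unfolding \<U>_def by (intro order_trans[OF card_image_le] card_mono) auto
    also have "\<dots> \<le> s" using card_image_le[of "{..<s}" "\<lambda>l. S \<inter> block l"] by simp
    finally have "card (e ` \<U>) \<le> s" .
    moreover have "card {a \<in> e ` \<U>. \<beta> a b} = of_bool (b \<in> S)" if b: "b < s * d" for b
    proof -
      have "\<beta> (e U) b \<longleftrightarrow> b \<in> U" if "U \<in> \<U>" for U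
        using that \<U> inj_onD[OF e(2)] unfolding \<beta>_def by blast
      then have eq: "{a \<in> e ` \<U>. \<beta> a b} = e ` {U \<in> \<U>. b \<in> U}" by auto
      have block: "b \<in> block l \<longleftrightarrow> l = b div d" for l
        using assms(2) by (auto simp: block_def div_nat_eqI dividend_less_times_div mult.commute)
      have "b div d < s" using b assms(2) by (simp add: less_mult_imp_div_less)
      then have "{U \<in> \<U>. b \<in> U} = (if b \<in> S then {S \<inter> block (b div d)} else {})"
        using block by (auto simp: \<U>_def)
      then show ?thesis unfolding eq by simp
    qed
    moreover have "e ` \<U> \<subseteq> {..<k}" using e(1) \<U> by blast
    ultimately show "\<exists>A\<subseteq>{..<k}. card A \<le> s \<and> (\<forall>b<s * d. card {a \<in> A. \<beta> a b} = of_bool (b \<in> S))"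
      by (intro exI[of _ "e ` \<U>"]) simp
  qed
qed

text \<open>Multiplying the labels by \<open>w\<close> turns the counts \<open>0\<close> and
  \<open>1\<close> into the required values. Bits from \<open>d\<close> on are given weight
  \<open>0\<close>, so a long code also serves for fewer bits.\<close>

lemma encodes_if_bit_code:
  assumes code: "bit_code k d' P" and d: "d \<le> d'"
    and X: "\<And>A. (\<And>i. i < n \<Longrightarrow> A i \<subseteq> {..<k} \<and> P (card (A i))) \<Longrightarrow>
      mat n k (\<lambda>(i, a). of_bool (a \<in> A i)) \<in> \<X>"
  shows "encodes \<X> n k d"
  unfolding encodes_def
proof (intro allI)
  fix w :: "nat \<Rightarrow> real"
  obtain \<beta> where \<beta>: "\<forall>S\<subseteq>{..<d'}. \<exists>A\<subseteq>{..<k}. P (card A) \<and> (\<forall>b<d'. card {a \<in> A. \<beta> a b} = of_bool (b \<in> S))"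
    using code unfolding bit_code_def by blast
  define \<beta>' where "\<beta>' a b = of_bool (\<beta> a b \<and> b < d) * w b" for a b
  have "\<exists>X\<in>\<X>. X \<in> carrier_mat n k \<and>
      (\<forall>i<n. \<forall>b. (\<Sum>a<k. X $$ (i, a) * \<beta>' a b) = 0 + of_bool (b \<in> S i \<and> b < d) * w b)"
    for S :: "nat \<Rightarrow> nat set"
  proof -
    have "\<forall>i. \<exists>A\<subseteq>{..<k}. P (card A) \<and> (\<forall>b<d'. card {a \<in> A. \<beta> a b} = of_bool (b \<in> S i \<inter> {..<d'}))"
      using \<beta> by (intro allI) (meson inf_le2)
    then obtain A where A: "\<And>i. A i \<subseteq> {..<k}" "\<And>i. P (card (A i))"
      "\<And>i b. b < d' \<Longrightarrow> card {a \<in> A i. \<beta> a b} = of_bool (b \<in> S i \<inter> {..<d'})"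
      by metis
    let ?X = "mat n k (\<lambda>(i, a). of_bool (a \<in> A i)) :: real mat"
    have "(\<Sum>a<k. ?X $$ (i, a) * \<beta>' a b) = 0 + of_bool (b \<in> S i \<and> b < d) * w b" if "i < n" for i b
    proof -
      have "(\<Sum>a<k. ?X $$ (i, a) * \<beta>' a b) = (\<Sum>a<k. if a \<in> A i \<and> \<beta> a b then of_bool (b < d) * w b else 0)"
        using that by (intro sum.cong refl) (auto simp: \<beta>'_def)
      also have "\<dots> = (\<Sum>a\<in>{a \<in> {..<k}. a \<in> A i \<and> \<beta> a b}. of_bool (b < d) * w b)"
        by (subst sum.inter_filter) auto
      also have "{a \<in> {..<k}. a \<in> A i \<and> \<beta> a b} = {a \<in> A i. \<beta> a b}"
        using A(1) by blast
      also have "(\<Sum>a\<in>{a \<in> A i. \<beta> a b}. of_bool (b < d) * w b) = of_bool (b \<in> S i \<and> b < d) * w b"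
        using A(3)[of b i] d by (cases "b < d") auto
      finally show ?thesis by simp
    qed
    then show ?thesis
      using X[of A] A by (intro bexI[of _ ?X]) auto
  qed
  then show "\<exists>\<beta> off. \<forall>S. \<exists>X\<in>\<X>. X \<in> carrier_mat n k \<and>
      (\<forall>i<n. \<forall>b. (\<Sum>a<k. X $$ (i, a) * \<beta> a b) = off b + of_bool (b \<in> S i \<and> b < d) * w b)"
    by (intro exI[of _ \<beta>'] exI[of _ "\<lambda>_. 0"]) blast
qed

section \<open>Factor classes that encode enough bits per row\<close>

lemma l0_norm_indicator:
  assumes "A \<subseteq> {..<k}"
  shows "l0_norm (Matrix.vec k (\<lambda>j. of_bool (j \<in> A))) = card A"
proof -
  have "{j. j < dim_vec (Matrix.vec k (\<lambda>j. of_bool (j \<in> A) :: real)) \<and>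
      vec_index (Matrix.vec k (\<lambda>j. of_bool (j \<in> A))) j \<noteq> (0 :: real)} = A"
    using assms by auto
  then show ?thesis unfolding l0_norm_def by simp
qed

lemma indicator_mat_in_factor_class:
  assumes "{0, 1} \<subseteq> D" "s \<ge> 1" "\<And>i. i < n \<Longrightarrow> A i \<subseteq> {..<k} \<and> card (A i) \<le> s"
  shows "mat n k (\<lambda>(i, a). of_bool (a \<in> A i)) \<in> factor_class D n k s"
  using assms by (auto simp: factor_class_def l0_norm_indicator elements_mat_def)

lemma indicator_mat_in_factor_class_exact:
  assumes "{0, 1} \<subseteq> D" "s \<ge> 1" "\<And>i. i < n \<Longrightarrow> A i \<subseteq> {..<k} \<and> card (A i) = s"
  shows "mat n k (\<lambda>(i, a). of_bool (a \<in> A i)) \<in> factor_class_exact D n k s"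
  using assms by (auto simp: factor_class_exact_def l0_norm_indicator elements_mat_def)

text \<open>For \<open>s = 0\<close> the identity is the only factor available, and this puts the
  selector into the class.\<close>

lemma selector_eq_one:
  assumes "n = k"
  shows "selector n k = 1\<^sub>m n"
  using assms by (intro eq_matI) (auto simp: selector_def)

lemma selector_eq_indicator: "selector n k = mat n k (\<lambda>(i, a). of_bool (a \<in> {min i (k - 1)}))"
  by (simp add: selector_def)

text \<open>All that the lower bound asks of one factor. \<open>r\<close> will be the number of
  usable columns on the other side, such as \<open>min m l\<close>; a row must encode
  \<open>d \<le> r\<close> bits, enough to pay for its share of \<open>factor_rate\<close> up to the
  constant \<open>3\<close>.\<close>

definition rich_factor :: "real mat set \<Rightarrow> nat \<Rightarrow> nat \<Rightarrow> nat \<Rightarrow> bool" where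
  "rich_factor \<X> n k s \<longleftrightarrow> \<X> \<subseteq> carrier_mat n k \<and> selector n k \<in> \<X> \<and>
     (\<forall>r. \<exists>d\<le>r. encodes \<X> n k d \<and> factor_rate n k s r \<le> 3 * real n * real d)"

lemma encodes_0:
  assumes "X \<in> \<X>" "X \<in> carrier_mat n k"
  shows "encodes \<X> n k 0"
  unfolding encodes_def using assms
  by (intro allI exI[of _ "\<lambda>_ _. 0"] exI[of _ "\<lambda>_. 0"] bexI[of _ X]) auto

text \<open>The two cases match the two arguments of the minimum in \<open>factor_rate\<close>:
  either \<open>r\<close> or the code length \<open>d'\<close> is the smaller one.\<close>

lemma factor_rate_le:
  assumes "real s * ln (exp 1 * real k / real s) \<le> 3 * real d'" "d = min r d'"
  shows "factor_rate n k s r \<le> 3 * real n * real d"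
proof (cases "r \<le> d'")
  case True
  have "factor_rate n k s r \<le> real n * real r" by (simp add: factor_rate_def)
  also have "\<dots> \<le> 3 * (real n * real r)" by simp
  finally show ?thesis using True assms by simp
next
  case False
  have "factor_rate n k s r \<le> real n * (real s * ln (exp 1 * real k / real s))"
    by (simp add: factor_rate_def mult.assoc)
  also have "\<dots> \<le> real n * (3 * real d')"
    using assms(1) by (intro mult_left_mono) auto
  finally show ?thesis using False assms by simp
qed

lemma rich_factorI:
  assumes "\<X> \<subseteq> carrier_mat n k" "selector n k \<in> \<X>" "\<And>r. encodes \<X> n k (min r d)"
    and "real s * ln (exp 1 * real k / real s) \<le> 3 * real d"
  shows "rich_factor \<X> n k s"
  unfolding rich_factor_def
proof (intro conjI allI exI)
  show "min r d \<le> r" for r by simp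
  show "factor_rate n k s r \<le> 3 * real n * real (min r d)" for r
    using assms(4) by (rule factor_rate_le) simp
qed (rule assms)+

lemma rich_factor_identity: "rich_factor {1\<^sub>m n} n n 0"
proof -
  have "encodes {1\<^sub>m n} n n 0" by (rule encodes_0[of "1\<^sub>m n"]) auto
  then show ?thesis
    unfolding rich_factor_def by (auto simp: selector_eq_one factor_rate_def)
qed

text \<open>\<open>1 + (d + 1) * ln 2 \<le> d + 2 \<le> 3 * d\<close>, which is where the constant
  \<open>3\<close> of \<open>rich_factor\<close> comes from.\<close>

lemma ln_le_bits:
  assumes "x > 0" "x \<le> 2 ^ (d + 1)" "d \<ge> 1"
  shows "ln (exp 1 * x) \<le> 3 * real d"
proof -
  have "ln x \<le> ln (2 ^ (d + 1))"
    using assms by (subst ln_le_cancel_iff) auto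
  also have "\<dots> = real (d + 1) * ln 2" by (rule ln_realpow)
  also have "\<dots> \<le> real (d + 1) * 1"
    using ln_2_less_1 by (intro mult_left_mono) auto
  finally show ?thesis using assms by (simp add: ln_mult)
qed

text \<open>Ties the code length to the rate: \<open>P d\<close> will provide the code, and the
  failure of \<open>P (d + 1)\<close> an upper bound for \<open>k\<close>.\<close>

lemma ex_maximal_bits:
  fixes P :: "nat \<Rightarrow> bool"
  assumes "P 1" "\<And>d. P d \<Longrightarrow> d \<le> K"
  shows "\<exists>d. d \<ge> 1 \<and> P d \<and> \<not> P (d + 1)"
proof (intro exI conjI)
  let ?d = "GREATEST d. P d"
  show "P ?d" using assms by (intro GreatestI_nat[of P 1 K]) auto
  show "?d \<ge> 1" using assms by (intro Greatest_le_nat[of P 1 K]) auto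
  show "\<not> P (?d + 1)" using Greatest_le_nat[of P "?d + 1" K] assms by auto
qed

text \<open>With \<open>d\<close> maximal for \<open>s * (2 ^ d - 1) \<le> k\<close>, the block code
  stores \<open>s * d\<close> bits in a row, while maximality gives
  \<open>k / s \<le> 2 ^ (d + 1)\<close>. The value \<open>d = 1\<close> is admissible because
  \<open>s \<le> k\<close>.\<close>

lemma rich_factor_class_sparse:
  assumes "1 \<le> s" "s \<le> k" "{0, 1} \<subseteq> D"
  shows "rich_factor (factor_class D n k s) n k s"
proof -
  have bound: "d \<le> k" if "s * (2 ^ d - 1) \<le> k" for d
  proof -
    have "d < 2 ^ d" by (rule less_exp)
    then have "d \<le> 1 * (2 ^ d - 1)" unfolding mult_1 by arith
    also have "\<dots> \<le> s * (2 ^ d - 1)" using assms by (intro mult_right_mono) auto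
    finally show ?thesis using that by simp
  qed
  have "\<exists>d. d \<ge> 1 \<and> s * (2 ^ d - 1) \<le> k \<and> \<not> s * (2 ^ (d + 1) - 1) \<le> k"
    by (rule ex_maximal_bits[of "\<lambda>d. s * (2 ^ d - 1) \<le> k", OF _ bound]) (use assms in simp_all)
  then obtain d where d: "d \<ge> 1" "s * (2 ^ d - 1) \<le> k" "\<not> s * (2 ^ (d + 1) - 1) \<le> k"
    by blast
  have "real k \<le> real (s * (2 ^ (d + 1) - 1))" using d(3) by linarith
  also have "\<dots> \<le> real s * 2 ^ (d + 1)" by (simp add: of_nat_diff mult_left_mono)
  finally have "real k / real s \<le> 2 ^ (d + 1)"
    using assms by (simp add: divide_le_eq mult.commute)
  then have "ln (exp 1 * (real k / real s)) \<le> 3 * real d"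
    using assms d by (intro ln_le_bits) auto
  then have "real s * ln (exp 1 * (real k / real s)) \<le> real s * (3 * real d)"
    by (intro mult_left_mono) auto
  then have rate: "real s * ln (exp 1 * real k / real s) \<le> 3 * real (s * d)"
    by simp
  have "encodes (factor_class D n k s) n k (min r (s * d))" for r
    using assms
    by (intro encodes_if_bit_code[OF bit_code_blocks[OF d(2,1)]] indicator_mat_in_factor_class) auto
  moreover have "selector n k \<in> factor_class D n k s"
    unfolding selector_eq_indicator using assms by (intro indicator_mat_in_factor_class) auto
  moreover have "factor_class D n k s \<subseteq> carrier_mat n k"
    using assms by (auto simp: factor_class_def)
  ultimately show ?thesis
    using rate by (intro rich_factorI)
qed

text \<open>A row is one nonzero letter, so bit \<open>0\<close> is written by choosing between
  \<open>1\<close> and a further letter \<open>c\<close>.\<close>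

lemma encodes_single_column:
  assumes "{0, 1} \<subseteq> D" "D \<noteq> {0, 1}"
  shows "encodes (factor_class_exact D n 1 1) n 1 1"
  unfolding encodes_def
proof (intro allI)
  fix w :: "nat \<Rightarrow> real"
  obtain c where c: "c \<in> D" "c \<noteq> 0" "c \<noteq> 1" using assms by blast
  \<comment> \<open>The letter \<open>1\<close> yields the offset \<open>w 0 / (c - 1)\<close>, and
    replacing it by \<open>c\<close> adds exactly \<open>w 0\<close>.\<close>
  define \<beta> where "\<beta> b = (if b = 0 then w 0 / (c - 1) else 0)" for b :: nat
  have "\<exists>X\<in>factor_class_exact D n 1 1. X \<in> carrier_mat n 1 \<and>
      (\<forall>i<n. \<forall>b. (\<Sum>a<1. X $$ (i, a) * \<beta> b) = \<beta> b + of_bool (b \<in> S i \<and> b < 1) * w b)"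
    for S :: "nat \<Rightarrow> nat set"
  proof -
    let ?X = "mat n 1 (\<lambda>(i, a). if 0 \<in> S i then c else 1)"
    have "l0_norm (row ?X i) = 1" if "i < n" for i
    proof -
      have "{j. j < dim_vec (row ?X i) \<and> vec_index (row ?X i) j \<noteq> 0} = {0}"
        using that c by auto
      then show ?thesis unfolding l0_norm_def by simp
    qed
    moreover have "elements_mat ?X \<subseteq> D"
      using assms c by (auto simp: elements_mat_def)
    ultimately have "?X \<in> factor_class_exact D n 1 1"
      by (simp add: factor_class_exact_def)
    moreover have "c * (w 0 / (c - 1)) = w 0 / (c - 1) + w 0"
      using c by (simp add: field_simps)
    ultimately show ?thesis
      by (intro bexI[of _ ?X]) (auto simp: \<beta>_def intro: gr0I)
  qed
  then show "\<exists>\<beta> off. \<forall>S. \<exists>X\<in>factor_class_exact D n 1 1. X \<in> carrier_mat n 1 \<and>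
      (\<forall>i<n. \<forall>b. (\<Sum>a<1. X $$ (i, a) * \<beta> a b) = off b + of_bool (b \<in> S i \<and> b < 1) * w b)"
    by (intro exI[of _ "\<lambda>_. \<beta>"] exI[of _ \<beta>]) blast
qed

text \<open>For \<open>k \<ge> 2\<close> the position of the single nonzero entry carries the bits.
  For \<open>k = 1\<close> only its value can, hence the exclusion of the alphabet
  \<open>{0, 1}\<close>.\<close>

lemma rich_factor_class_exact_1:
  assumes "1 \<le> k" "{0, 1} \<subseteq> D" "\<not> (k = 1 \<and> D = {0, 1})"
  shows "rich_factor (factor_class_exact D n k 1) n k 1"
proof -
  have "\<exists>d. (\<forall>r. encodes (factor_class_exact D n k 1) n k (min r d)) \<and>
      real 1 * ln (exp 1 * real k / real 1) \<le> 3 * real d"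
  proof (cases "k = 1")
    case True
    have sel: "selector n 1 \<in> factor_class_exact D n 1 1"
      unfolding selector_eq_indicator using assms by (intro indicator_mat_in_factor_class_exact) auto
    have "D \<noteq> {0, 1}" using assms True by blast
    then have "encodes (factor_class_exact D n 1 1) n 1 (min r 1)" for r
      using encodes_single_column[OF assms(2)] encodes_0[OF sel selector_carrier]
      by (cases "r = 0") (simp_all add: min_absorb2)
    then show ?thesis using True by (intro exI[of _ 1]) auto
  next
    case False
    have bound: "d \<le> k" if "2 ^ d \<le> k" for d using less_exp[of d] that by linarith
    have "\<exists>d. d \<ge> 1 \<and> 2 ^ d \<le> k \<and> \<not> 2 ^ (d + 1) \<le> k"
      by (rule ex_maximal_bits[of "\<lambda>d. 2 ^ d \<le> k", OF _ bound]) (use False assms in simp_all)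
    then obtain d where d: "d \<ge> 1" "2 ^ d \<le> k" "\<not> 2 ^ (d + 1) \<le> k"
      by blast
    have "real k \<le> real (2 ^ (d + 1))" using d(3) by (intro of_nat_mono) simp
    then have "ln (exp 1 * real k) \<le> 3 * real d"
      using assms d by (intro ln_le_bits) auto
    moreover have "encodes (factor_class_exact D n k 1) n k (min r d)" for r
      using assms
      by (intro encodes_if_bit_code[OF bit_code_singleton[OF d(2)]] indicator_mat_in_factor_class_exact) auto
    ultimately show ?thesis by auto
  qed
  then obtain d where d: "\<And>r. encodes (factor_class_exact D n k 1) n k (min r d)"
    and rate: "real 1 * ln (exp 1 * real k / real 1) \<le> 3 * real d" by blast
  moreover have "selector n k \<in> factor_class_exact D n k 1"
    unfolding selector_eq_indicator using assms by (intro indicator_mat_in_factor_class_exact) auto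
  moreover have "factor_class_exact D n k 1 \<subseteq> carrier_mat n k"
    by (auto simp: factor_class_exact_def)
  ultimately show ?thesis
    using rate by (intro rich_factorI)
qed

section \<open>Assembling the three cubes into the lower bounds\<close>

text \<open>The largest of the three cubes suffices: the terms of the rate are at most
  \<open>3\<close>, \<open>1\<close> and \<open>3\<close> times its number of bits.\<close>

lemma contains_cube_total_rate:
  assumes X: "rich_factor \<X> n k s" and Z: "rich_factor \<Z> m l s'"
    and pos: "n \<ge> 1" "m \<ge> 1" "k \<ge> 1" "l \<ge> 1" and v: "v \<ge> 0"
  obtains N where "N \<ge> 1" "contains_cube n m v (bilinear_class \<X> \<Z> k l) N"
    "total_rate n m k l s s' \<le> 7 * real N"
proof -
  let ?C = "contains_cube n m v (bilinear_class \<X> \<Z> k l)"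
  obtain d where d: "d \<le> min m l" "encodes \<X> n k d"
    "factor_rate n k s (min m l) \<le> 3 * real n * real d"
    using X unfolding rich_factor_def by blast
  obtain d' where d': "d' \<le> min n k" "encodes \<Z> m l d'"
    "factor_rate m l s' (min n k) \<le> 3 * real m * real d'"
    using Z unfolding rich_factor_def by blast
  have sel: "selector n k \<in> \<X>" "selector m l \<in> \<Z>"
    and car: "\<X> \<subseteq> carrier_mat n k" "\<Z> \<subseteq> carrier_mat m l"
    using X Z by (auto simp: rich_factor_def)
  have "?C (min n k * min m l)"
    using pos sel v by (intro contains_cube_core)
  moreover have "?C (n * d)"
    using d pos sel v by (intro contains_cube_factor)
  moreover have "?C (m * d')"
    using d' pos sel v contains_cube_transpose[OF contains_cube_factor transpose_bilinear_class[OF car(2,1)]]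
    by blast
  moreover define N where "N = max (max (n * d) (min n k * min m l)) (m * d')"
  ultimately have "?C N" 
    by (simp add: max_def)
  moreover have "N \<ge> 1" using pos by (simp add: N_def le_max_iff_disj)
  moreover have "total_rate n m k l s s' \<le> 7 * real N"
  proof -
    have "real (n * d) \<le> real N" "real (min n k * min m l) \<le> real N" "real (m * d') \<le> real N"
      unfolding N_def by (intro of_nat_mono; simp)+
    then show ?thesis
      using d(3) d'(3) unfolding total_rate_def of_nat_mult by linarith
  qed
  ultimately show ?thesis by (intro that)
qed

lemma bilinear_class_carrier:
  assumes "\<X> \<subseteq> carrier_mat n k" "\<Z> \<subseteq> carrier_mat m l"
  shows "bilinear_class \<X> \<Z> k l \<subseteq> carrier_mat n m"
  using assms by (fastforce simp: bilinear_class_def)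

text \<open>Even \<open>10 * t\<close> is at most \<open>70 / 2400\<close> times
  \<open>\<sigma>^2 / p * N\<close>, below the \<open>3 / 80 = 90 / 2400\<close> that
  \<open>cube_minimax_prob\<close> allows. The factor \<open>10\<close> is kept in reserve for the
  risk.\<close>

lemma minimax_lower_bound:
  assumes X: "rich_factor \<X> n k s" and Z: "rich_factor \<Z> m l s'"
    and pos: "n \<ge> 1" "m \<ge> 1" "k \<ge> 1" "l \<ge> 1"
    and p: "0 < p" "p \<le> 1" and sigma: "\<sigma> > 0"
  defines "t \<equiv> 1 / 2400 * \<sigma>\<^sup>2 / p * total_rate n m k l s s'"
  shows "minimax_prob n m p \<sigma> (bilinear_class \<X> \<Z> k l) t \<ge> ennreal 0.1"
    and "minimax_risk n m p \<sigma> (bilinear_class \<X> \<Z> k l) \<ge> ennreal t"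
proof -
  let ?\<Theta> = "bilinear_class \<X> \<Z> k l"
  have v: "\<sigma>\<^sup>2 / p \<ge> 0" using p by simp
  obtain N where N: "N \<ge> 1" "contains_cube n m (\<sigma>\<^sup>2 / p) ?\<Theta> N"
    "total_rate n m k l s s' \<le> 7 * real N"
    using contains_cube_total_rate[OF X Z pos v] by blast
  have rate: "\<sigma>\<^sup>2 / p * total_rate n m k l s s' \<le> 7 * (\<sigma>\<^sup>2 / p * real N)"
    using mult_left_mono[OF N(3) v] by (simp add: mult.left_commute)
  have vN: "\<sigma>\<^sup>2 / p * real N \<ge> 0" using v by (rule mult_nonneg_nonneg) simp
  have t_eq: "t = 1 / 2400 * (\<sigma>\<^sup>2 / p * total_rate n m k l s s')"
    by (simp add: t_def)
  have prob: "minimax_prob n m p \<sigma> ?\<Theta> u \<ge> ennreal 0.1" if "u \<le> 3 / 80 * (\<sigma>\<^sup>2 / p * real N)" for u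
    using cube_minimax_prob[OF p sigma N(2,1)] that by (simp add: mult.assoc)
  show "minimax_prob n m p \<sigma> ?\<Theta> t \<ge> ennreal 0.1"
    using rate vN unfolding t_eq by (intro prob) linarith
  show "minimax_risk n m p \<sigma> ?\<Theta> \<ge> ennreal t"
  proof (cases "t \<ge> 0")
    case True
    \<comment> \<open>Markov's inequality at the threshold \<open>10 * t\<close> loses the
      probability \<open>0.1\<close> and leaves exactly \<open>t\<close>.\<close>
    have "ennreal t = ennreal (10 * t) * ennreal 0.1"
      using True by (simp add: ennreal_mult[symmetric])
    also have "\<dots> \<le> ennreal (10 * t) * minimax_prob n m p \<sigma> ?\<Theta> (10 * t)"
      using rate vN unfolding t_eq by (intro mult_left_mono prob) (linarith, simp)
    also have "\<dots> \<le> minimax_risk n m p \<sigma> ?\<Theta>"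
      using True sigma X Z
      by (intro minimax_risk_ge bilinear_class_carrier) (auto simp: rich_factor_def)
    finally show ?thesis .
  qed (simp add: ennreal_neg)
qed

lemma signal_class_eq:
  "signal_class D D' n m k l s s' = bilinear_class (factor_class D n k s) (factor_class D' m l s') k l"
  by (simp add: signal_class_def bilinear_class_def)

lemma signal_class_exact_eq:
  "signal_class_exact D D' n m k l s s' =
     bilinear_class (factor_class_exact D n k s) (factor_class_exact D' m l s') k l"
  by (simp add: signal_class_exact_def bilinear_class_def)

lemma rich_factor_class:
  assumes "s \<le> k" "s = 0 \<longrightarrow> n = k" "{0, 1} \<subseteq> D"
  shows "rich_factor (factor_class D n k s) n k s"
proof (cases "s = 0")
  case True
  then show ?thesis using rich_factor_identity[of n] assms by (simp add: factor_class_def)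
qed (use assms rich_factor_class_sparse in simp)

lemma rich_factor_class_exact:
  assumes "k \<ge> 1" "s \<in> {0, 1}" "s = 0 \<longrightarrow> n = k" "{0, 1} \<subseteq> D" "\<not> (s = 1 \<and> k = 1 \<and> D = {0, 1})"
  shows "rich_factor (factor_class_exact D n k s) n k s"
proof (cases "s = 0")
  case True
  then show ?thesis using rich_factor_identity[of n] assms by (simp add: factor_class_exact_def)
next
  case False
  then have "s = 1" using assms by simp
  then show ?thesis using assms rich_factor_class_exact_1 by blast
qed

theorem theorem3:
  "\<exists>C::real. C > 0 \<and>
    (\<forall>(n::nat) (m::nat) (k\<^sub>n::nat) (k\<^sub>m::nat) (s\<^sub>n::nat) (s\<^sub>m::nat)
       (D\<^sub>n::real set) (D\<^sub>m::real set) (p::real) (\<sigma>::real).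
      n \<ge> 1 \<longrightarrow> m \<ge> 1 \<longrightarrow> k\<^sub>n \<ge> 1 \<longrightarrow> k\<^sub>m \<ge> 1 \<longrightarrow> s\<^sub>n \<le> k\<^sub>n \<longrightarrow> s\<^sub>m \<le> k\<^sub>m \<longrightarrow>
      (s\<^sub>n = 0 \<longrightarrow> n = k\<^sub>n) \<longrightarrow> (s\<^sub>m = 0 \<longrightarrow> m = k\<^sub>m) \<longrightarrow>
      {0, 1} \<subseteq> D\<^sub>n \<longrightarrow> {0, 1} \<subseteq> D\<^sub>m \<longrightarrow> 0 < p \<longrightarrow> p \<le> 1 \<longrightarrow> \<sigma> > 0 \<longrightarrow>
      (let \<Theta> = signal_class D\<^sub>n D\<^sub>m n m k\<^sub>n k\<^sub>m s\<^sub>n s\<^sub>m;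
           \<Theta>' = signal_class_exact D\<^sub>n D\<^sub>m n m k\<^sub>n k\<^sub>m s\<^sub>n s\<^sub>m;
           t = C * \<sigma>\<^sup>2 / p * total_rate n m k\<^sub>n k\<^sub>m s\<^sub>n s\<^sub>m
       in minimax_prob n m p \<sigma> \<Theta> t \<ge> ennreal 0.1 \<and>
          minimax_risk n m p \<sigma> \<Theta> \<ge> ennreal t \<and>
          (s\<^sub>n \<in> {0, 1} \<longrightarrow> s\<^sub>m \<in> {0, 1} \<longrightarrow>
           \<not> (s\<^sub>n = 1 \<and> k\<^sub>n = 1 \<and> D\<^sub>n = {0, 1}) \<longrightarrow>
           \<not> (s\<^sub>m = 1 \<and> k\<^sub>m = 1 \<and> D\<^sub>m = {0, 1}) \<longrightarrow>
             minimax_prob n m p \<sigma> \<Theta>' t \<ge> ennreal 0.1 \<and>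
             minimax_risk n m p \<sigma> \<Theta>' \<ge> ennreal t)))"
proof (intro exI[of _ "1 / 2400"] conjI allI impI)
  fix n m k\<^sub>n k\<^sub>m s\<^sub>n s\<^sub>m :: nat and D\<^sub>n D\<^sub>m :: "real set" and p \<sigma> :: real
  assume pos: "n \<ge> 1" "m \<ge> 1" "k\<^sub>n \<ge> 1" "k\<^sub>m \<ge> 1" and p: "0 < p" "p \<le> 1" "\<sigma> > 0"
    and n: "s\<^sub>n \<le> k\<^sub>n" "s\<^sub>n = 0 \<longrightarrow> n = k\<^sub>n" "{0, 1} \<subseteq> D\<^sub>n"
    and m: "s\<^sub>m \<le> k\<^sub>m" "s\<^sub>m = 0 \<longrightarrow> m = k\<^sub>m" "{0, 1} \<subseteq> D\<^sub>m"
  note lower = minimax_lower_bound[OF rich_factor_class[OF n] rich_factor_class[OF m] pos p]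
  note lower_exact = minimax_lower_bound[OF rich_factor_class_exact[OF pos(3) _ n(2,3)]
      rich_factor_class_exact[OF pos(4) _ m(2,3)] pos p]
  show "let \<Theta> = signal_class D\<^sub>n D\<^sub>m n m k\<^sub>n k\<^sub>m s\<^sub>n s\<^sub>m;
           \<Theta>' = signal_class_exact D\<^sub>n D\<^sub>m n m k\<^sub>n k\<^sub>m s\<^sub>n s\<^sub>m;
           t = 1 / 2400 * \<sigma>\<^sup>2 / p * total_rate n m k\<^sub>n k\<^sub>m s\<^sub>n s\<^sub>m
       in minimax_prob n m p \<sigma> \<Theta> t \<ge> ennreal 0.1 \<and>
          minimax_risk n m p \<sigma> \<Theta> \<ge> ennreal t \<and>
          (s\<^sub>n \<in> {0, 1} \<longrightarrow> s\<^sub>m \<in> {0, 1} \<longrightarrow>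
           \<not> (s\<^sub>n = 1 \<and> k\<^sub>n = 1 \<and> D\<^sub>n = {0, 1}) \<longrightarrow>
           \<not> (s\<^sub>m = 1 \<and> k\<^sub>m = 1 \<and> D\<^sub>m = {0, 1}) \<longrightarrow>
             minimax_prob n m p \<sigma> \<Theta>' t \<ge> ennreal 0.1 \<and>
             minimax_risk n m p \<sigma> \<Theta>' \<ge> ennreal t)"
    unfolding Let_def signal_class_eq signal_class_exact_eq
    by (intro conjI impI lower lower_exact)
qed simp

end
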